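(* Let $N$ be an oriented lattice of rank $2$, let $P\subset N_{\mathbb{Q}}$ be a Fano polygon, and let $Q=\mathbf{quiv}(N,P)$ be its polygonal quiver. For every vertex $m$ of $Q$, put $h_{\max}=\sup\{\langle m,x\rangle \mid x\in P\}$, $h_{\min}=\inf\{\langle m,x\rangle \mid x\in P\}$ and $D(m)=h_{\max}-h_{\min}$. Then $$D(m)=\sum_{h\in \mathrm{out}(m)} w_h\cdot \mathrm{a}(m,h)=\sum_{t\in \mathrm{in}(m)} w_t\cdot \mathrm{a}(t,m),$$ where each vertex $q$ of $Q$ carries the label $(w_q,\ell_q)$.
   Context: Let $N$ be an oriented lattice of rank $2$, $N_{\mathbb{Q}}=N\otimes_{\mathbb{Z}}\mathbb{Q}$, $M=\mathrm{Hom}(N,\mathbb{Z})$. Using an orientation-preserving isomorphism $N\cong\mathbb{Z}^2$ and dual coordinates on $M$, put $\det((a,b)^t,(c,d)^t)=ad-bc$ on $M$ (independent of the isomorphism). A Fano polygon $P\subset N_{\mathbb{Q}}$ is a $2$-dimensional lattice polytope containing the origin in its strict interior, all of whose vertices are primitive lattice vectors. Its spanning fan $\Sigma_P$ is the complete fan whose cones are the cones over the proper faces of $P$. For a $2$-dimensional strictly convex rational cone $\sigma\subset N_{\mathbb{Q}}$ with primitive generators $u,v$: the inner normal vector $m_\sigma\in M$ is the unique primitive vector with $\langle m_\sigma,u\rangle=\langle m_\sigma,v\rangle<0$; the local index is $\ell_\sigma=-\langle m_\sigma,u\rangle$; the width is $w_\sigma=|\mathrm{conv}\{u,v\}\cap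 N|-1$. Write $w_\sigma=\alpha\ell_\sigma+\rho$ with $0\le\rho<\ell_\sigma$. A standard refinement of $\sigma$ is a subdivision of $\sigma$ by rays through primitive lattice points in the strict interior of $\mathrm{conv}\{u,v\}$ into $\alpha$ subcones with width and local index both $\ell_\sigma$ (primitive $T$-cones) and, if $\rho>0$, one further subcone of width $\rho$ and local index $\ell_\sigma$ (an $R$-cone). A standard refinement $\Sigma$ of $\Sigma_P$ is a choice of standard refinement of each maximal cone of $\Sigma_P$. The polygonal quiver $\mathbf{quiv}(N,P)$ has as vertices the multiset $\{m_\sigma\mid\sigma\text{ a maximal cone of }\Sigma\}$ (one vertex per maximal cone of $\Sigma$), where $m_\sigma$ is labelled by $(w_\sigma,\ell_\sigma)$. Between $m_\sigma$ and $m_\tau$ there are $|\det(m_\sigma,m_\tau)|$ arrows, pointing from $m_\sigma$ to $m_\tau$ if $\det(m_\sigma,m_\tau)>0$ and from $m_\tau$ to $m_\sigma$ if it is negative. This is independent of the choice of $\Sigma$. For vertices $x,y$ of a quiver without self-loops or $2$-cycles, $\mathrm{a}(x,y)$ is the signed number of arrows between them: positive if arrows point from $x$ to $y$, negative if from $y$ to $x$, zero if there are none. $\mathrm{out}(m)$ is the set of vertices receiving an arrow from $m$, and $\mathrm{in}(m)$ is the set of vertices from which $m$ receives an arrow. *)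

theory Defs
  imports Complex_Main "Graph_Theory.Digraph"
begin

section \<open>Oriented lattices of rank 2\<close>

text \<open>
  The type \<open>'v\<close> with scalar multiplication \<open>scale\<close> is the rational vector space \<open>N\<^sub>Q\<close>, and
  \<open>N\<close> sits inside it as the \<open>\<int>\<close>-span of a \<open>\<rat>\<close>-basis, so that \<open>N\<^sub>Q\<close> is \<open>N \<otimes> \<rat>\<close>. The orientation
  is recorded as the set \<open>Or\<close> of positively oriented \<open>\<int>\<close>-bases of \<open>N\<close>; an element of \<open>Or\<close> is the
  same thing as an orientation-preserving isomorphism from \<open>N\<close> to \<open>\<int> \<times> \<int>\<close>.
\<close>

definition (in vector_space) lattice_basis :: "'b set \<Rightarrow> 'b \<times> 'b \<Rightarrow> bool" where
  "lattice_basis N = (\<lambda>(b1, b2).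
     b1 \<noteq> b2 \<and> independent {b1, b2} \<and> span {b1, b2} = UNIV \<and>
     N = {of_int i *s b1 + of_int j *s b2 | i j :: int. True})"

locale oriented_lattice = vector_space scale
  for scale :: "rat \<Rightarrow> 'v::ab_group_add \<Rightarrow> 'v" (infixr \<open>*s\<close> 75) +
  fixes N :: "'v set" and Or :: "('v \<times> 'v) set"
  assumes orientation:
    "\<exists>b1 b2. lattice_basis N (b1, b2) \<and>
       Or = {(c1, c2). lattice_basis N (c1, c2) \<and>
               (\<exists>p q r s. c1 = p *s b1 + q *s b2 \<and> c2 = r *s b1 + s *s b2 \<and> p * s - q * r > 0)}"

text \<open>Used both for \<open>N\<close> in \<open>N\<^sub>Q\<close> and for \<open>M\<close> in the dual space; it excludes \<open>0 = 2 \<cdot> 0\<close>.\<close>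

definition primitive :: "(rat \<Rightarrow> 'a \<Rightarrow> 'a) \<Rightarrow> 'a set \<Rightarrow> 'a \<Rightarrow> bool" where
  "primitive sc L x \<longleftrightarrow> x \<in> L \<and> (\<forall>(k::nat) y. y \<in> L \<and> x = sc (of_nat k) y \<longrightarrow> k = 1)"

context oriented_lattice
begin

text \<open>
  An element of \<open>M = Hom(N, \<int>)\<close> is represented by its unique linear extension to \<open>N\<^sub>Q\<close>, so
  that the pairing of \<open>m\<close> with \<open>x\<close> is \<open>m x\<close>.
\<close>

definition M :: "('v \<Rightarrow> rat) set" where
  "M = {m. Vector_Spaces.linear scale (*) m \<and> m ` N \<subseteq> \<int>}"

definition primitive_N :: "'v \<Rightarrow> bool" where
  "primitive_N = primitive scale N"

definition primitive_M :: "('v \<Rightarrow> rat) \<Rightarrow> bool" where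
  "primitive_M = primitive (\<lambda>c m x. c * m x) M"

text \<open>
  The dual coordinates of \<open>m\<close> are \<open>(m b1, m b2)\<close>. The choice of the positive basis is
  irrelevant, see \<open>M_det_eq\<close> below.
\<close>

definition M_det :: "('v \<Rightarrow> rat) \<Rightarrow> ('v \<Rightarrow> rat) \<Rightarrow> rat" where
  "M_det m m' = (case (SOME b. b \<in> Or) of (b1, b2) \<Rightarrow> m b1 * m' b2 - m b2 * m' b1)"


section \<open>Polytopes and cones in \<open>N\<^sub>Q\<close>\<close>

text \<open>The library's convex geometry is about real vector spaces; here the scalars are rational.\<close>

definition conv_hull :: "'v set \<Rightarrow> 'v set" where
  "conv_hull S = {\<Sum>x\<in>T. c x *s x | T c.
     finite T \<and> T \<subseteq> S \<and> (\<forall>x\<in>T. 0 \<le> c x) \<and> sum c T = 1}"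

definition cone_hull :: "'v set \<Rightarrow> 'v set" where
  "cone_hull S = {\<Sum>x\<in>T. c x *s x | T c. finite T \<and> T \<subseteq> S \<and> (\<forall>x\<in>T. 0 \<le> c x)}"

text \<open>The functional \<open>f\<close> may be \<open>0\<close>: the empty set and \<open>P\<close> itself are faces of \<open>P\<close>.\<close>

definition face :: "'v set \<Rightarrow> 'v set \<Rightarrow> bool" where
  "face P F \<longleftrightarrow> (\<exists>f h. Vector_Spaces.linear scale (*) f \<and> (\<forall>x\<in>P. f x \<le> h) \<and> F = {x \<in> P. f x = h})"

text \<open>
  The topology of \<open>N\<^sub>Q\<close> is given by coordinate boxes; the choice of the basis does not affect it.
\<close>

definition strict_interior :: "'v set \<Rightarrow> 'v set" where
  "strict_interior P = {x. \<exists>b1 b2 \<epsilon>. lattice_basis N (b1, b2) \<and> \<epsilon> > 0 \<and>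
     (\<forall>s t. \<bar>s\<bar> < \<epsilon> \<and> \<bar>t\<bar> < \<epsilon> \<longrightarrow> x + s *s b1 + t *s b2 \<in> P)}"

definition lattice_polytope :: "'v set \<Rightarrow> bool" where
  "lattice_polytope P \<longleftrightarrow> (\<exists>S. finite S \<and> S \<subseteq> N \<and> P = conv_hull S)"

definition fano_polygon :: "'v set \<Rightarrow> bool" where
  "fano_polygon P \<longleftrightarrow>
     lattice_polytope P \<and> dim {x - y | x y. x \<in> P \<and> y \<in> P} = 2 \<and>
     0 \<in> strict_interior P \<and> (\<forall>v. face P {v} \<longrightarrow> primitive_N v)"

text \<open>The empty face contributes the cone \<open>{0}\<close>.\<close>

definition spanning_fan :: "'v set \<Rightarrow> 'v set set" where
  "spanning_fan P = {cone_hull F | F. face P F \<and> F \<noteq> P}"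

definition maximal_cones :: "'v set set \<Rightarrow> 'v set set" where
  "maximal_cones \<F> = {\<sigma> \<in> \<F>. \<forall>\<tau>\<in>\<F>. \<sigma> \<subseteq> \<tau> \<longrightarrow> \<tau> = \<sigma>}"


section \<open>Invariants of a two-dimensional strictly convex rational cone\<close>

definition prim_gens :: "'v set \<Rightarrow> 'v set" where
  "prim_gens \<sigma> = (THE G. \<exists>u v. G = {u, v} \<and> u \<noteq> v \<and> independent {u, v} \<and>
     primitive_N u \<and> primitive_N v \<and> \<sigma> = cone_hull {u, v})"

definition inner_normal :: "'v set \<Rightarrow> 'v \<Rightarrow> rat" where
  "inner_normal \<sigma> = (THE m. primitive_M m \<and> (\<exists>l<0. \<forall>u\<in>prim_gens \<sigma>. m u = l))"

definition local_index :: "'v set \<Rightarrow> nat" where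
  "local_index \<sigma> = (THE l. \<forall>u\<in>prim_gens \<sigma>. of_nat l = - inner_normal \<sigma> u)"

definition width :: "'v set \<Rightarrow> nat" where
  "width \<sigma> = card (conv_hull (prim_gens \<sigma>) \<inter> N) - 1"


section \<open>Standard refinements\<close>

text \<open>
  The maximal cones of the subdivision of \<open>\<sigma>\<close> by the rays through the points of \<open>R\<close>: each is
  generated by two neighbouring points among \<open>R\<close> and the primitive generators of \<open>\<sigma>\<close>.
\<close>

definition ray_subdivision :: "'v set \<Rightarrow> 'v set \<Rightarrow> 'v set set" where
  "ray_subdivision \<sigma> R =
     (let R' = R \<union> prim_gens \<sigma> in
      {cone_hull {a, b} | a b. a \<in> R' \<and> b \<in> R' \<and> a \<noteq> b \<and> conv_hull {a, b} \<inter> R' = {a, b}})"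

text \<open>
  Refinements are represented by their sets of maximal cones, which determine them.
\<close>

definition standard_cone_refinement :: "'v set \<Rightarrow> 'v set set \<Rightarrow> bool" where
  "standard_cone_refinement \<sigma> S \<longleftrightarrow>
     (let l = local_index \<sigma>; \<alpha> = width \<sigma> div l; \<rho> = width \<sigma> mod l in
      (\<exists>R. R \<subseteq> conv_hull (prim_gens \<sigma>) - prim_gens \<sigma> \<and> (\<forall>x\<in>R. primitive_N x) \<and>
           S = ray_subdivision \<sigma> R) \<and>
      (\<forall>\<tau>\<in>S. local_index \<tau> = l \<and> (width \<tau> = l \<or> \<rho> > 0 \<and> width \<tau> = \<rho>)) \<and>
      card {\<tau>\<in>S. width \<tau> = l} = \<alpha> \<and>
      (\<rho> > 0 \<longrightarrow> card {\<tau>\<in>S. width \<tau> = \<rho>} = 1))"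

definition standard_refinement :: "'v set \<Rightarrow> 'v set set \<Rightarrow> bool" where
  "standard_refinement P \<Sigma> \<longleftrightarrow>
     (\<exists>S. (\<forall>\<sigma>\<in>maximal_cones (spanning_fan P). standard_cone_refinement \<sigma> (S \<sigma>)) \<and>
          \<Sigma> = (\<Union>\<sigma>\<in>maximal_cones (spanning_fan P). S \<sigma>))"

end


text \<open>The supremum and infimum are taken in \<open>\<real>\<close>, as \<open>\<rat>\<close> is not conditionally complete.\<close>

definition h_max :: "'v set \<Rightarrow> ('v \<Rightarrow> rat) \<Rightarrow> real" where
  "h_max P m = Sup {real_of_rat (m x) | x. x \<in> P}"

definition h_min :: "'v set \<Rightarrow> ('v \<Rightarrow> rat) \<Rightarrow> real" where
  "h_min P m = Inf {real_of_rat (m x) | x. x \<in> P}"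

definition height_range :: "'v set \<Rightarrow> ('v \<Rightarrow> rat) \<Rightarrow> real" where
  "height_range P m = h_max P m - h_min P m"


section \<open>Quivers\<close>

text \<open>
  A quiver is a directed multigraph. In a polygonal quiver each vertex \<open>q\<close> stands for the lattice
  vector \<open>vec Q q\<close>; different vertices may carry the same vector, so that the vectors form a multiset.
  The label is the pair of width and local index.
\<close>

record ('a, 'b, 'm) vector_quiver = "('a, 'b) pre_digraph" +
  vec :: "'a \<Rightarrow> 'm"
  label :: "'a \<Rightarrow> nat \<times> nat"

text \<open>Without 2-cycles, at most one of the two terms is nonzero.\<close>

definition signed_arrows :: "('a, 'b, 'c) pre_digraph_scheme \<Rightarrow> 'a \<Rightarrow> 'a \<Rightarrow> int" where
  "signed_arrows Q x y =
     int (card {e \<in> arcs Q. tail Q e = x \<and> head Q e = y}) -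
     int (card {e \<in> arcs Q. tail Q e = y \<and> head Q e = x})"

definition out_nbrs :: "('a, 'b, 'c) pre_digraph_scheme \<Rightarrow> 'a \<Rightarrow> 'a set" where
  "out_nbrs Q m = {h \<in> verts Q. \<exists>e\<in>arcs Q. tail Q e = m \<and> head Q e = h}"

definition in_nbrs :: "('a, 'b, 'c) pre_digraph_scheme \<Rightarrow> 'a \<Rightarrow> 'a set" where
  "in_nbrs Q m = {t \<in> verts Q. \<exists>e\<in>arcs Q. tail Q e = t \<and> head Q e = m}"

context oriented_lattice
begin

text \<open>
  \<open>\<Sigma>\<close> is the set of maximal cones of a standard refinement. \<open>M_det\<close> is integral on \<open>M\<close>
  (see \<open>M_det_Ints\<close>), so there are exactly \<open>\<bar>M_det m m'\<bar>\<close> indices \<open>k\<close> below.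
\<close>

definition quiv ::
    "'v set set \<Rightarrow> ('v set, 'v set \<times> 'v set \<times> nat, 'v \<Rightarrow> rat) vector_quiver" where
  "quiv \<Sigma> = \<lparr>
     verts = \<Sigma>,
     arcs = {(\<sigma>, \<tau>, k). \<sigma> \<in> \<Sigma> \<and> \<tau> \<in> \<Sigma> \<and> M_det (inner_normal \<sigma>) (inner_normal \<tau>) > 0 \<and>
               of_nat k < \<bar>M_det (inner_normal \<sigma>) (inner_normal \<tau>)\<bar>},
     tail = fst,
     head = fst \<circ> snd,
     vec = inner_normal,
     label = (\<lambda>\<sigma>. (width \<sigma>, local_index \<sigma>))\<rparr>"

section \<open>Well-definedness of the determinant\<close>

lemma M_linear:
  assumes "m \<in> M"
  shows "m (p *s x + q *s y) = p * m x + q * m y"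
proof -
  interpret L: Vector_Spaces.linear scale "(*)" m
    using assms by (simp add: M_def)
  show ?thesis by (simp add: L.add L.scale)
qed

lemma basis_coords_unique:
  assumes "lattice_basis N (b1, b2)" "p *s b1 + q *s b2 = p' *s b1 + q' *s b2"
  shows "p = p' \<and> q = q'"
proof -
  have ind: "independent {b1, b2}" "b1 \<noteq> b2"
    using assms by (auto simp: lattice_basis_def)
  have 0: "(p - p') *s b1 + (q - q') *s b2 = 0"
    using assms(2) by (simp add: scale_left_diff_distrib algebra_simps)
  have "(\<Sum>v\<in>{b1, b2}. (if v = b1 then p - p' else q - q') *s v) = 0"
    using ind(2) 0 by auto
  then have "\<forall>v\<in>{b1, b2}. (if v = b1 then p - p' else q - q') = 0"
    using ind(1) independentD[of "{b1, b2}" "{b1, b2}" "\<lambda>v. if v = b1 then p - p' else q - q'"]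
    by auto
  with ind(2) show ?thesis by auto
qed

lemma lattice_basis_coords:
  assumes "lattice_basis N (b1, b2)" "x \<in> N"
  obtains i j :: int where "x = of_int i *s b1 + of_int j *s b2"
  using assms by (auto simp: lattice_basis_def)

lemma lattice_basis_mem:
  assumes "lattice_basis N (b1, b2)"
  shows "b1 \<in> N" "b2 \<in> N"
proof -
  have "b1 = of_int 1 *s b1 + of_int 0 *s b2" "b2 = of_int 0 *s b1 + of_int 1 *s b2" by auto
  then show "b1 \<in> N" "b2 \<in> N" using assms unfolding lattice_basis_def by blast+
qed

lemma det_change:
  assumes "m \<in> M" "m' \<in> M"
    and "c1 = p *s b1 + q *s b2" "c2 = r *s b1 + s *s b2"
  shows "m c1 * m' c2 - m c2 * m' c1 = (p * s - q * r) * (m b1 * m' b2 - m b2 * m' b1)"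
  using assms by (simp add: M_linear algebra_simps)

lemma lattice_basis_change:
  assumes b: "lattice_basis N (b1, b2)" and c: "lattice_basis N (c1, c2)"
    and e: "c1 = p *s b1 + q *s b2" "c2 = r *s b1 + s *s b2"
    and pos: "p * s - q * r > 0"
  shows "p * s - q * r = 1"
proof -
  obtain i j where i: "c1 = of_int i *s b1 + of_int j *s b2"
    using lattice_basis_coords[OF b] lattice_basis_mem[OF c] by metis
  obtain k l where k: "c2 = of_int k *s b1 + of_int l *s b2"
    using lattice_basis_coords[OF b] lattice_basis_mem[OF c] by metis
  obtain i' j' where i': "b1 = of_int i' *s c1 + of_int j' *s c2"
    using lattice_basis_coords[OF c] lattice_basis_mem[OF b] by metis
  obtain k' l' where k': "b2 = of_int k' *s c1 + of_int l' *s c2"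
    using lattice_basis_coords[OF c] lattice_basis_mem[OF b] by metis
  have pq: "p = of_int i" "q = of_int j" "r = of_int k" "s = of_int l"
    using basis_coords_unique[OF b] i k e by metis+
  have "1 *s b1 + 0 *s b2
      = of_int (i' * i + j' * k) *s b1 + of_int (i' * j + j' * l) *s b2"
    by (subst i', subst i, subst k)
      (simp add: scale_right_distrib scale_left_distrib algebra_simps)
  then have A: "1 = (of_int (i' * i + j' * k) :: rat)" "0 = (of_int (i' * j + j' * l) :: rat)"
    using basis_coords_unique[OF b] by metis+
  have "0 *s b1 + 1 *s b2
      = of_int (k' * i + l' * k) *s b1 + of_int (k' * j + l' * l) *s b2"
    by (subst k', subst i, subst k)
      (simp add: scale_right_distrib scale_left_distrib algebra_simps)
  then have B: "0 = (of_int (k' * i + l' * k) :: rat)" "1 = (of_int (k' * j + l' * l) :: rat)"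
    using basis_coords_unique[OF b] by metis+
  have A': "i' * i + j' * k = 1" "i' * j + j' * l = 0"
    and B': "k' * i + l' * k = 0" "k' * j + l' * l = 1"
    using A B by linarith+
  have "(i' * l' - j' * k') * (i * l - j * k)
      = (i' * i + j' * k) * (k' * j + l' * l) - (i' * j + j' * l) * (k' * i + l' * k)"
    by algebra
  also have "\<dots> = 1" using A' B' by simp
  finally have "i * l - j * k = 1 \<or> i * l - j * k = - 1"
    using zmult_eq_1_iff by blast
  moreover have "i * l - j * k > 0"
    using pos unfolding pq by (metis of_int_0_less_iff of_int_diff of_int_mult)
  ultimately have "i * l - j * k = 1" by linarith
  then show ?thesis unfolding pq by (metis of_int_1 of_int_diff of_int_mult)
qed

lemma M_det_eq:
  assumes "m \<in> M" "m' \<in> M" "(c1, c2) \<in> Or"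
  shows "M_det m m' = m c1 * m' c2 - m c2 * m' c1"
proof -
  obtain b1 b2 where b: "lattice_basis N (b1, b2)"
    and Or: "Or = {(c1, c2). lattice_basis N (c1, c2) \<and>
               (\<exists>p q r s. c1 = p *s b1 + q *s b2 \<and> c2 = r *s b1 + s *s b2 \<and> p * s - q * r > 0)}"
    using orientation by blast
  have *: "m d1 * m' d2 - m d2 * m' d1 = m b1 * m' b2 - m b2 * m' b1" if dOr: "(d1, d2) \<in> Or" for d1 d2
  proof -
    obtain p q r s where d: "lattice_basis N (d1, d2)" "d1 = p *s b1 + q *s b2"
      "d2 = r *s b1 + s *s b2" "p * s - q * r > 0"
      using dOr unfolding Or by blast
    show ?thesis
      using det_change[OF assms(1,2) d(2,3)] lattice_basis_change[OF b d] by simp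
  qed
  obtain d1 d2 where d: "(SOME b. b \<in> Or) = (d1, d2)" by fastforce
  moreover have "(SOME b. b \<in> Or) \<in> Or" using assms(3) by (rule someI)
  ultimately show ?thesis
    using *[of d1 d2] *[OF assms(3)] by (simp add: M_det_def)
qed

lemma Or_nonempty: "Or \<noteq> {}"
proof -
  obtain b1 b2 where b: "lattice_basis N (b1, b2)"
    and Or: "Or = {(c1, c2). lattice_basis N (c1, c2) \<and>
               (\<exists>p q r s. c1 = p *s b1 + q *s b2 \<and> c2 = r *s b1 + s *s b2 \<and> p * s - q * r > 0)}"
    using orientation by blast
  have "b1 = 1 *s b1 + 0 *s b2 \<and> b2 = 0 *s b1 + 1 *s b2 \<and> (1::rat) * 1 - 0 * 0 > 0" by simp
  then have "(b1, b2) \<in> Or" using b unfolding Or by blast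
  then show ?thesis by blast
qed

lemma M_det_Ints:
  assumes "m \<in> M" "m' \<in> M"
  shows "M_det m m' \<in> \<int>"
proof -
  obtain b1 b2 where b: "(b1, b2) \<in> Or" using Or_nonempty by auto
  then have "lattice_basis N (b1, b2)" using orientation by auto
  then have "b1 \<in> N" "b2 \<in> N" by (rule lattice_basis_mem)+
  then have "m b1 \<in> \<int>" "m b2 \<in> \<int>" "m' b1 \<in> \<int>" "m' b2 \<in> \<int>"
    using assms by (auto simp: M_def)
  then show ?thesis using M_det_eq[OF assms b] by simp
qed

end

end

theory Submission
  imports Defs
begin

text \<open>
  For a maximal cone over an edge of \<open>P\<close> from \<open>u\<close> to \<open>v\<close>, in counterclockwise order,
  \<open>v - u = w d\<close> with \<open>w\<close> the width and \<open>d\<close> primitive, and the inner normal is the determinant with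
  \<open>d\<close>. Hence \<open>w\<close> times the number of signed arrows from \<open>m\<close> is \<open>m (v - u)\<close>, the height gained
  along the edge. A standard refinement splits an edge into segments with the same inner normal and
  the same total width. The positive height gains along the boundary telescope: a vertex that ends
  an increasing edge and does not start one is a local, hence a global maximum of \<open>m\<close> on \<open>P\<close>, the
  orientation makes it unique, and the same holds for the minimum. As the total gain is zero, the
  descending edges give the same sum.
\<close>

section \<open>Convex hulls and cones\<close>

text \<open>Every functional on the plane is some \<open>vdet c\<close>, so supporting lines, inner
  normals and edge vectors are all handled as vectors, and convexity arguments become signs of 2 by
  2 determinants. The scalars being rational, each extremal point is found by a maximum over the
  finite generating set. No cyclic enumeration of the vertices is set up: \<open>edges\<close> is a
  set of directed pairs cut out by determinant conditions, and the enumeration is replaced by the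
  fact that both projections from it to the vertices are bijections. A second obstacle is that the
  vertices of the quiver form a set of cones. Pieces cut from different edges must be shown to be
  different, which is why the value of the normal on the generators of a piece is carried along with
  the normal itself.\<close>

context vector_space
begin

lemma linear_functionalI:
  fixes f :: "'b \<Rightarrow> 'a"
  assumes "\<And>x y. f (x + y) = f x + f y" "\<And>c x. f (scale c x) = c * f x"
  shows "Vector_Spaces.linear scale (*) f"
proof -
  have "vector_space ((*) :: 'a \<Rightarrow> 'a \<Rightarrow> 'a)" by unfold_locales (simp_all add: algebra_simps)
  then show ?thesis
    using vector_space_axioms assms
    by (intro Vector_Spaces.linear.intro module_hom.intro module_hom_axioms.intro)
      (simp_all add: vector_space_def module_def)
qed

lemma linear_functional_comb:
  assumes "Vector_Spaces.linear scale (*) f"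
  shows "f (x + y) = f x + f y" "f (scale c x) = c * f x" "f (x - y) = f x - f y"
    "f (\<Sum>i\<in>A. g i) = (\<Sum>i\<in>A. f (g i))"
proof -
  interpret L: Vector_Spaces.linear scale "(*)" f by (rule assms)
  show "f (x + y) = f x + f y" "f (scale c x) = c * f x" "f (x - y) = f x - f y"
    "f (\<Sum>i\<in>A. g i) = (\<Sum>i\<in>A. f (g i))"
    by (simp_all add: L.add L.scale L.diff L.sum)
qed

end

context oriented_lattice
begin

lemma conv_hullI:
  assumes "finite T" "T \<subseteq> S" "\<And>x. x \<in> T \<Longrightarrow> 0 \<le> c x" "sum c T = 1" "y = (\<Sum>x\<in>T. c x *s x)"
  shows "y \<in> conv_hull S"
  unfolding conv_hull_def mem_Collect_eq using assms
  by (intro exI[of _ T] exI[of _ c]) simp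

lemma cone_hullI:
  assumes "finite T" "T \<subseteq> S" "\<And>x. x \<in> T \<Longrightarrow> 0 \<le> c x" "y = (\<Sum>x\<in>T. c x *s x)"
  shows "y \<in> cone_hull S"
  unfolding cone_hull_def mem_Collect_eq using assms
  by (intro exI[of _ T] exI[of _ c]) simp

lemma conv_hull_subset: "S \<subseteq> conv_hull S"
  by (auto intro: conv_hullI[of "{x}" S "\<lambda>_. 1" x for x])

lemma conv_hull_le:
  assumes f: "Vector_Spaces.linear scale (*) f" and le: "\<And>s. s \<in> S \<Longrightarrow> f s \<le> h"
    and y: "y \<in> conv_hull S"
  shows "f y \<le> h"
proof -
  obtain T c where T: "y = (\<Sum>x\<in>T. c x *s x)" "finite T" "T \<subseteq> S" "\<forall>x\<in>T. 0 \<le> c x" "sum c T = 1"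
    using y unfolding conv_hull_def by blast
  have "f y = (\<Sum>x\<in>T. c x * f x)" by (simp add: T(1) linear_functional_comb[OF f])
  also have "\<dots> \<le> (\<Sum>x\<in>T. c x * h)" using T le by (intro sum_mono mult_left_mono) auto
  also have "\<dots> = h" using T(5) by (simp add: sum_distrib_right[symmetric])
  finally show ?thesis .
qed

text \<open>The slacks \<open>h - f x\<close> are nonnegative and their weighted mean vanishes, so
  all the weight sits on points of \<open>S\<close> that attain \<open>h\<close>.\<close>

lemma conv_hull_face:
  assumes f: "Vector_Spaces.linear scale (*) f" and le: "\<And>s. s \<in> S \<Longrightarrow> f s \<le> h"
    and y: "y \<in> conv_hull S" and fy: "f y = h"
  shows "y \<in> conv_hull {s \<in> S. f s = h}"
proof -
  obtain T c where T: "y = (\<Sum>x\<in>T. c x *s x)" "finite T" "T \<subseteq> S" "\<forall>x\<in>T. 0 \<le> c x" "sum c T = 1"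
    using y unfolding conv_hull_def by blast
  have "(\<Sum>x\<in>T. c x * (h - f x)) = sum c T * h - f y"
    by (simp add: T(1) linear_functional_comb[OF f] sum_subtractf sum_distrib_right right_diff_distrib)
  then have "(\<Sum>x\<in>T. c x * (h - f x)) = 0" using fy T(5) by simp
  moreover have "\<forall>x\<in>T. c x * (h - f x) \<ge> 0" using T le by force
  ultimately have z: "\<forall>x\<in>T. c x * (h - f x) = 0" using T(2) by (simp add: sum_nonneg_eq_0_iff)
  define T' where "T' = {x \<in> T. f x = h}"
  have out: "\<forall>x\<in>T - T'. c x = 0" using z by (auto simp: T'_def)
  have "y = (\<Sum>x\<in>T'. c x *s x)" unfolding T(1)
    by (rule sum.mono_neutral_right) (use T out in \<open>auto simp: T'_def\<close>)
  moreover have "sum c T' = 1" unfolding T(5)[symmetric]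
    by (rule sum.mono_neutral_left) (use T out in \<open>auto simp: T'_def\<close>)
  moreover have "finite T'" "T' \<subseteq> {s \<in> S. f s = h}" "\<forall>x\<in>T'. 0 \<le> c x" using T by (auto simp: T'_def)
  ultimately show ?thesis by (auto intro!: conv_hullI[of T' _ c])
qed

lemma conv_hull_pairI:
  assumes "0 \<le> t" "t \<le> 1" shows "(1 - t) *s u + t *s v \<in> conv_hull {u, v}"
proof (cases "u = v")
  case True
  then have "(1 - t) *s u + t *s v = u" by (simp add: scale_left_distrib[symmetric])
  then show ?thesis using conv_hull_subset[of "{u, v}"] by auto
next
  case False
  define c where "c = (\<lambda>x. if x = u then 1 - t else t)"
  show ?thesis by (rule conv_hullI[of "{u, v}" _ c]) (use False assms in \<open>auto simp: c_def\<close>)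
qed

lemma conv_hull_pairE:
  assumes "y \<in> conv_hull {u, v}"
  obtains t where "0 \<le> t" "t \<le> 1" "y = (1 - t) *s u + t *s v"
proof -
  obtain T c where T: "y = (\<Sum>x\<in>T. c x *s x)" "finite T" "T \<subseteq> {u, v}" "\<forall>x\<in>T. 0 \<le> c x" "sum c T = 1"
    using assms unfolding conv_hull_def by blast
  \<comment> \<open>\<open>T\<close> may omit \<open>u\<close> or \<open>v\<close>; the missing
    weight is set to 0.\<close>
  define d where "d = (\<lambda>x. if x \<in> T then c x else 0)"
  have y: "y = (\<Sum>x\<in>{u,v}. d x *s x)" unfolding T(1)
    by (rule sum.mono_neutral_cong_left) (use T in \<open>auto simp: d_def\<close>)
  have 1: "sum d {u, v} = 1" unfolding T(5)[symmetric]
    by (rule sum.mono_neutral_cong_right) (use T in \<open>auto simp: d_def\<close>)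
  have nn: "d u \<ge> 0" "d v \<ge> 0" using T by (auto simp: d_def)
  show ?thesis
  proof (cases "u = v")
    case True
    show ?thesis by (rule that[of 0]) (use True y 1 in auto)
  next
    case False
    then have "d u = 1 - d v" using 1 by simp
    then show ?thesis using that[of "d v"] False y nn by simp
  qed
qed

section \<open>Cones spanned by two vectors\<close>

lemma cone_hull_mono: "S \<subseteq> T \<Longrightarrow> cone_hull S \<subseteq> cone_hull T"
  unfolding cone_hull_def by blast

lemma cone_hull_pairI:
  assumes "0 \<le> a" "0 \<le> b" "u \<noteq> v" shows "a *s u + b *s v \<in> cone_hull {u, v}"
proof -
  define c where "c = (\<lambda>x. if x = u then a else b)"
  show ?thesis by (rule cone_hullI[of "{u, v}" _ c]) (use assms in \<open>auto simp: c_def\<close>)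
qed

lemma cone_hull_subset_pair:
  assumes "S \<subseteq> {a *s u + b *s v | a b. 0 \<le> a \<and> 0 \<le> b}"
  shows "cone_hull S \<subseteq> {a *s u + b *s v | a b. 0 \<le> a \<and> 0 \<le> b}" (is "_ \<subseteq> ?C")
proof
  fix y assume "y \<in> cone_hull S"
  then obtain T c where T: "y = (\<Sum>x\<in>T. c x *s x)" "finite T" "T \<subseteq> S" "\<forall>x\<in>T. 0 \<le> c x"
    unfolding cone_hull_def by blast
  have add: "x + z \<in> ?C" if xz: "x \<in> ?C" "z \<in> ?C" for x z
  proof -
    obtain a b a' b' where "x = a *s u + b *s v" "z = a' *s u + b' *s v"
      and nn: "0 \<le> a" "0 \<le> b" "0 \<le> a'" "0 \<le> b'" using xz by blast
    then have "x + z = (a + a') *s u + (b + b') *s v" by (simp add: scale_left_distrib)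
    then show ?thesis using nn add_nonneg_nonneg by blast
  qed
  have sc: "r *s x \<in> ?C" if rx: "x \<in> ?C" "0 \<le> r" for r x
  proof -
    obtain a b where "x = a *s u + b *s v" and nn: "0 \<le> a" "0 \<le> b" using rx by blast
    then have "r *s x = (r * a) *s u + (r * b) *s v" by (simp add: scale_right_distrib)
    then show ?thesis using nn rx(2) mult_nonneg_nonneg by blast
  qed
  have "0 = 0 *s u + 0 *s v" by simp
  then have z: "0 \<in> ?C" by blast
  have "T \<subseteq> S \<Longrightarrow> \<forall>x\<in>T. 0 \<le> c x \<Longrightarrow> (\<Sum>x\<in>T. c x *s x) \<in> ?C" using T(2)
  proof (induction T rule: finite_induct)
    case empty
    show ?case using z by (simp only: sum.empty)
  next
    case (insert x T)
    have "c x *s x \<in> ?C" using insert.prems assms by (intro sc) auto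
    moreover have "(\<Sum>x\<in>T. c x *s x) \<in> ?C" using insert.prems by (intro insert.IH) auto
    ultimately have "c x *s x + (\<Sum>x\<in>T. c x *s x) \<in> ?C" by (rule add)
    then show ?case by (simp only: sum.insert[OF insert.hyps])
  qed
  then show "y \<in> ?C" using T by simp
qed

lemma cone_hull_pair:
  assumes "u \<noteq> v" shows "cone_hull {u, v} = {a *s u + b *s v | a b. 0 \<le> a \<and> 0 \<le> b}"
proof
  have "u = 1 *s u + 0 *s v" "v = 0 *s u + 1 *s v" by auto
  then have "{u, v} \<subseteq> {a *s u + b *s v | a b. 0 \<le> a \<and> 0 \<le> b}"
    by (smt (verit) insert_subset mem_Collect_eq subsetI empty_iff zero_le_one order_refl)
  then show "cone_hull {u, v} \<subseteq> {a *s u + b *s v | a b. 0 \<le> a \<and> 0 \<le> b}"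
    by (rule cone_hull_subset_pair)
  show "{a *s u + b *s v | a b. 0 \<le> a \<and> 0 \<le> b} \<subseteq> cone_hull {u, v}"
    using assms by (auto intro: cone_hull_pairI)
qed

lemma conv_hull_pair_subset_cone_hull: "u \<noteq> v \<Longrightarrow> conv_hull {u, v} \<subseteq> cone_hull {u, v}"
  by (auto elim!: conv_hull_pairE intro!: cone_hull_pairI)

lemma cone_hull_between:
  assumes "u \<noteq> v" "{u, v} \<subseteq> F" "F \<subseteq> cone_hull {u, v}"
  shows "cone_hull F = cone_hull {u, v}"
  using cone_hull_mono[OF assms(2)] cone_hull_subset_pair[of F u v] assms(3)
  by (auto simp: cone_hull_pair[OF assms(1)])

lemma lattice_basis_spans:
  assumes "lattice_basis N (c1, c2)" shows "\<exists>p q. x = p *s c1 + q *s c2"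
proof -
  have "x \<in> span {c1, c2}" using assms by (simp add: lattice_basis_def)
  then obtain p where "x - p *s c1 \<in> span {c2}" by (auto simp: span_insert)
  then obtain q where "x - p *s c1 - q *s c2 = 0" by (auto simp: span_insert[of c2 "{}"] span_empty)
  then have "x = p *s c1 + q *s c2" by (simp add: algebra_simps)
  then show ?thesis by blast
qed

end

section \<open>Coordinates\<close>

text \<open>A fixed positive basis; by \<open>M_det_eq\<close> it may replace the one chosen inside
  \<open>M_det\<close>.\<close>

locale lattice_frame = oriented_lattice scale N Or
  for scale :: "rat \<Rightarrow> 'v::ab_group_add \<Rightarrow> 'v" (infixr \<open>*s\<close> 75) and N Or +
  fixes b1 b2 :: 'v
  assumes frame: "(b1, b2) \<in> Or"
begin

lemma frame_basis: "lattice_basis N (b1, b2)"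
  using frame orientation by auto

definition coord1 :: "'v \<Rightarrow> rat" where "coord1 x = (SOME p. \<exists>q. x = p *s b1 + q *s b2)"
definition coord2 :: "'v \<Rightarrow> rat" where "coord2 x = (SOME q. x = coord1 x *s b1 + q *s b2)"

lemma coords: "x = coord1 x *s b1 + coord2 x *s b2"
proof -
  have "\<exists>q. x = coord1 x *s b1 + q *s b2" unfolding coord1_def using lattice_basis_spans[OF frame_basis] by (rule someI_ex)
  then show ?thesis unfolding coord2_def by (rule someI_ex)
qed

lemma coords_unique:
  assumes "x = p *s b1 + q *s b2" shows "coord1 x = p" "coord2 x = q"
  using basis_coords_unique[OF frame_basis trans[OF coords[symmetric] assms]] by auto

lemma coord_simps [simp]:
  "coord1 (x + y) = coord1 x + coord1 y" "coord2 (x + y) = coord2 x + coord2 y"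
  "coord1 (x - y) = coord1 x - coord1 y" "coord2 (x - y) = coord2 x - coord2 y"
  "coord1 (c *s x) = c * coord1 x" "coord2 (c *s x) = c * coord2 x"
  "coord1 (- x) = - coord1 x" "coord2 (- x) = - coord2 x"
  "coord1 0 = 0" "coord2 0 = 0"
  "coord1 b1 = 1" "coord2 b1 = 0" "coord1 b2 = 0" "coord2 b2 = 1"
proof -
  have xy: "x = coord1 x *s b1 + coord2 x *s b2" "y = coord1 y *s b1 + coord2 y *s b2"
    by (rule coords)+
  have "x + y = (coord1 x + coord1 y) *s b1 + (coord2 x + coord2 y) *s b2"
    by (subst xy(1), subst xy(2)) (simp add: scale_left_distrib)
  from coords_unique[OF this]
  show "coord1 (x + y) = coord1 x + coord1 y" "coord2 (x + y) = coord2 x + coord2 y" .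
  have "x - y = (coord1 x - coord1 y) *s b1 + (coord2 x - coord2 y) *s b2"
    by (subst xy(1), subst xy(2)) (simp add: scale_left_diff_distrib)
  from coords_unique[OF this]
  show "coord1 (x - y) = coord1 x - coord1 y" "coord2 (x - y) = coord2 x - coord2 y" .
  have "c *s x = (c * coord1 x) *s b1 + (c * coord2 x) *s b2"
    by (subst xy(1)) (simp add: scale_right_distrib)
  from coords_unique[OF this]
  show "coord1 (c *s x) = c * coord1 x" "coord2 (c *s x) = c * coord2 x" .
  have "- x = (- coord1 x) *s b1 + (- coord2 x) *s b2"
    by (subst xy(1)) simp
  from coords_unique[OF this]
  show "coord1 (- x) = - coord1 x" "coord2 (- x) = - coord2 x" .
  show "coord1 0 = 0" "coord2 0 = 0" using coords_unique[of 0 0 0] by auto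
  show "coord1 b1 = 1" "coord2 b1 = 0" using coords_unique[of b1 1 0] by auto
  show "coord1 b2 = 0" "coord2 b2 = 1" using coords_unique[of b2 0 1] by auto
qed

lemma eq_iff_coords: "x = y \<longleftrightarrow> coord1 x = coord1 y \<and> coord2 x = coord2 y"

proof
  assume "coord1 x = coord1 y \<and> coord2 x = coord2 y"
  then have "coord1 x *s b1 + coord2 x *s b2 = coord1 y *s b1 + coord2 y *s b2" by simp
  then show "x = y" by (simp only: coords[symmetric])
qed simp

lemma mem_N_iff: "x \<in> N \<longleftrightarrow> coord1 x \<in> \<int> \<and> coord2 x \<in> \<int>"
proof
  assume "x \<in> N"
  then obtain i j :: int where "x = of_int i *s b1 + of_int j *s b2"
    using lattice_basis_coords[OF frame_basis] by blast
  from coords_unique[OF this] show "coord1 x \<in> \<int> \<and> coord2 x \<in> \<int>" by simp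
next
  assume "coord1 x \<in> \<int> \<and> coord2 x \<in> \<int>"
  then obtain i j :: int where "coord1 x = of_int i" "coord2 x = of_int j" by (auto elim!: Ints_cases)
  then have "x = of_int i *s b1 + of_int j *s b2" using coords[of x] by metis
  then show "x \<in> N" using frame_basis unfolding lattice_basis_def by blast
qed

text \<open>The area form of the frame. It is unimodular on \<open>N\<close> and identifies the
  plane with its dual by sending \<open>c\<close> to \<open>vdet c\<close>. A positive
  \<open>vdet x y\<close> means that \<open>y\<close> is counterclockwise from
  \<open>x\<close>.\<close>

definition vdet :: "'v \<Rightarrow> 'v \<Rightarrow> rat" where
  "vdet x y = coord1 x * coord2 y - coord2 x * coord1 y"

lemma vdet_simps:
  "vdet (x + y) z = vdet x z + vdet y z" "vdet z (x + y) = vdet z x + vdet z y"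
  "vdet (x - y) z = vdet x z - vdet y z" "vdet z (x - y) = vdet z x - vdet z y"
  "vdet (c *s x) z = c * vdet x z" "vdet z (c *s x) = c * vdet z x"
  "vdet (- x) z = - vdet x z" "vdet z (- x) = - vdet z x"
  "vdet 0 z = 0" "vdet z 0 = 0" "vdet x x = 0"
  by (simp_all add: vdet_def algebra_simps)

lemma vdet_swap: "vdet x y = - vdet y x"
  by (simp add: vdet_def algebra_simps)

lemma linear_vdet: "Vector_Spaces.linear scale (*) (vdet c)"
  by (intro linear_functionalI) (simp_all add: vdet_simps)

text \<open>The representing vector is the coefficient vector \<open>(f b1, f b2)\<close> turned
  clockwise by a right angle.\<close>

lemma linear_functional_eq_vdet:
  assumes "Vector_Spaces.linear scale (*) f"
  shows "f x = vdet (f b2 *s b1 - f b1 *s b2) x"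
proof -
  have "f x = f (coord1 x *s b1 + coord2 x *s b2)" by (subst (1) coords[of x]) (rule refl)
  then show ?thesis by (simp add: linear_functional_comb[OF assms] vdet_def algebra_simps)
qed

lemma vdet_0_parallel:
  assumes "e \<noteq> 0" "vdet e z = 0"
  obtains t where "z = t *s e"
proof (cases "coord1 e = 0")
  case True
  then have e: "coord2 e \<noteq> 0" using assms(1) by (auto simp: eq_iff_coords)
  show ?thesis by (rule that[of "coord2 z / coord2 e"])
    (use e True assms in \<open>auto simp: eq_iff_coords vdet_def\<close>)
next
  case False
  show ?thesis by (rule that[of "coord1 z / coord1 e"])
    (use False assms in \<open>auto simp: eq_iff_coords vdet_def field_simps\<close>)
qed

lemma vdet_cramer:
  assumes "vdet a b \<noteq> 0"
  shows "z = (vdet z b / vdet a b) *s a + (vdet a z / vdet a b) *s b"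
proof -
  have "vdet a b *s z = vdet z b *s a + vdet a z *s b"
    by (simp add: eq_iff_coords vdet_def algebra_simps)
  then have "(1 / vdet a b) *s (vdet a b *s z) = (1 / vdet a b) *s (vdet z b *s a + vdet a z *s b)"
    by simp
  then show ?thesis using assms by (simp add: scale_right_distrib)
qed

end


section \<open>Vertices and edges of a polygon around the origin\<close>

text \<open>\<open>S\<close> is any finite generating set and may contain points that are not
  vertices.\<close>

locale polygon = lattice_frame +
  fixes S :: "'a set"
  assumes finite_S: "finite S" and zero_interior: "0 \<in> strict_interior (conv_hull S)"
begin

abbreviation P where "P \<equiv> conv_hull S"

lemma vdet_le_hull: "(\<And>s. s \<in> S \<Longrightarrow> vdet c s \<le> h) \<Longrightarrow> y \<in> P \<Longrightarrow> vdet c y \<le> h"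
  by (rule conv_hull_le[OF linear_vdet])

lemma box_around_zero:
  obtains c1 c2 e where "lattice_basis N (c1, c2)" "e > 0"
    "\<forall>s t. \<bar>s\<bar> < e \<and> \<bar>t\<bar> < e \<longrightarrow> s *s c1 + t *s c2 \<in> P"
proof -
  have "\<exists>c1 c2 e. lattice_basis N (c1, c2) \<and> e > 0 \<and>
     (\<forall>s t. \<bar>s\<bar> < e \<and> \<bar>t\<bar> < e \<longrightarrow> s *s c1 + t *s c2 \<in> P)"
    using zero_interior by (simp add: strict_interior_def)
  then show ?thesis by (elim exE conjE) (rule that)
qed

text \<open>A functional that is nonpositive on \<open>S\<close> is nonpositive on \<open>P\<close>,
  hence on small multiples of a lattice basis and of its negatives; it then vanishes on that
  basis.\<close>

lemma vdet_pos_exists: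
  assumes "c \<noteq> 0" obtains s where "s \<in> S" "vdet c s > 0"
proof -
  obtain c1 c2 e where c: "lattice_basis N (c1, c2)" and e: "e > 0"
    and box: "\<forall>s t. \<bar>s\<bar> < e \<and> \<bar>t\<bar> < e \<longrightarrow> s *s c1 + t *s c2 \<in> P"
    by (rule box_around_zero)
  have "\<exists>s\<in>S. vdet c s > 0"
  proof (rule ccontr)
    assume neg: "\<not> ?thesis"
    have le: "vdet c y \<le> 0" if "y \<in> P" for y using that by (rule vdet_le_hull[rotated]) (use neg in \<open>auto simp: not_less\<close>)
    have half: "\<bar>e / 2\<bar> < e" "\<bar>- (e / 2)\<bar> < e" using e by auto
    have "vdet c c1 = 0"
      using le[OF box[rule_format, of "e/2" 0]] le[OF box[rule_format, of "-(e/2)" 0]] half e by (simp add: vdet_simps mult_le_0_iff zero_le_mult_iff)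
    moreover have "vdet c c2 = 0"
      using le[OF box[rule_format, of 0 "e/2"]] le[OF box[rule_format, of 0 "-(e/2)"]] half e by (simp add: vdet_simps mult_le_0_iff zero_le_mult_iff)
    ultimately have 0: "vdet c x = 0" for x
      using lattice_basis_spans[OF c, of x] by (auto simp: vdet_simps)
    have "c = 0" using 0[of b1] 0[of b2] by (simp add: vdet_def eq_iff_coords)
    with assms show False by simp
  qed
  then show ?thesis using that by blast
qed

lemma zero_in_P: "0 \<in> P"
proof -
  obtain c1 c2 e where "e > 0"
    and box: "\<forall>s t. \<bar>s\<bar> < e \<and> \<bar>t\<bar> < e \<longrightarrow> s *s c1 + t *s c2 \<in> P"
    by (rule box_around_zero)
  then show ?thesis using box[rule_format, of 0 0] by simp
qed

text \<open>With the origin in the interior, no supporting line passes through it.\<close>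

lemma support_pos:
  assumes "c \<noteq> 0" "\<And>y. y \<in> P \<Longrightarrow> vdet c y \<le> h" shows "h > 0"
proof -
  obtain s where "s \<in> S" "vdet c s > 0" using vdet_pos_exists[OF assms(1)] .
  then show ?thesis using assms(2)[of s] conv_hull_subset by fastforce
qed

section \<open>Vertices and directed edges\<close>

definition is_vertex :: "'a \<Rightarrow> bool" where
  "is_vertex v \<longleftrightarrow> v \<in> S \<and> (\<exists>c. \<forall>s\<in>S - {v}. vdet c s < vdet c v)"

lemma is_vertex_in_P: "is_vertex v \<Longrightarrow> v \<in> P"
  using conv_hull_subset by (auto simp: is_vertex_def)

text \<open>Provides the faces \<open>{v}\<close> on which the Fano condition demands primitive
  vectors.\<close>

lemma is_vertex_face:
  assumes "is_vertex v" shows "face P {v}"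
proof -
  obtain c where v: "v \<in> S" and c: "\<forall>s\<in>S - {v}. vdet c s < vdet c v"
    using assms by (auto simp: is_vertex_def)
  have le: "vdet c s \<le> vdet c v" if "s \<in> S" for s using c that by (cases "s = v") (auto simp: less_imp_le)
  have only: "s = v" if "s \<in> S" "vdet c s = vdet c v" for s using bspec[OF c, of s] that by auto
  have "y = v" if y: "y \<in> P" "vdet c y = vdet c v" for y
  proof -
    have "y \<in> conv_hull {s \<in> S. vdet c s = vdet c v}"
      using le y by (intro conv_hull_face[OF linear_vdet])
    \<comment> \<open>The doubleton \<open>{v, v}\<close> makes the two-point description of hulls
      apply to a single point.\<close>
    moreover have "{s \<in> S. vdet c s = vdet c v} = {v, v}"
      using v only by auto
    ultimately obtain t where "y = (1 - t) *s v + t *s v" by (metis conv_hull_pairE)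
    then show ?thesis by (simp add: scale_left_distrib[symmetric])
  qed
  moreover have "\<forall>y\<in>P. vdet c y \<le> vdet c v" using vdet_le_hull[OF le] by blast
  ultimately show ?thesis
    unfolding face_def using linear_vdet is_vertex_in_P[OF assms]
    by (intro exI[of _ "vdet c"] exI[of _ "vdet c v"]) auto
qed

text \<open>A face of a face is a face: the functional \<open>e\<close> is perturbed by a large multiple of \<open>c\<close>.\<close>

lemma is_vertex_extreme:
  assumes le: "\<And>s. s \<in> S \<Longrightarrow> vdet c s \<le> vdet c v" and v: "v \<in> S"
    and e: "\<And>s. s \<in> S \<Longrightarrow> vdet c s = vdet c v \<Longrightarrow> s \<noteq> v \<Longrightarrow> vdet e s < vdet e v"
  shows "is_vertex v"
proof -
  \<comment> \<open>If \<open>vdet c s < vdet c v\<close>, the functional of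
    \<open>K *s c + e\<close> is larger at \<open>v\<close> than at \<open>s\<close> exactly when
    \<open>K > g s\<close>. On a tie the quotient \<open>x / 0 = 0\<close> is harmless, as
    \<open>e\<close> decides there.\<close>
  define g where "g = (\<lambda>s. (vdet e s - vdet e v) / (vdet c v - vdet c s))"
  define K where "K = 1 + (\<Sum>s\<in>S. \<bar>g s\<bar>)"
  have "vdet (K *s c + e) s < vdet (K *s c + e) v" if s: "s \<in> S - {v}" for s
  proof (cases "vdet c s = vdet c v")
    case True
    then show ?thesis using e s by (simp add: vdet_simps)
  next
    case False
    then have pos: "vdet c v - vdet c s > 0" using le[of s] s by simp
    have "\<bar>g s\<bar> \<le> (\<Sum>s\<in>S. \<bar>g s\<bar>)" using s finite_S by (intro member_le_sum) auto
    then have "g s < K" by (simp add: K_def)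
    then have "vdet e s - vdet e v < K * (vdet c v - vdet c s)"
      using pos by (simp add: g_def pos_divide_less_eq)
    then show ?thesis by (simp add: vdet_simps algebra_simps)
  qed
  then show ?thesis using v by (auto simp: is_vertex_def)
qed

text \<open>\<open>vdet v u\<close> is the common value of \<open>vdet (v - u)\<close> at
  \<open>u\<close> and at \<open>v\<close>. So \<open>P\<close> lies to the left of the directed
  line from \<open>u\<close> to \<open>v\<close> and meets it exactly in the segment; positivity of
  \<open>vdet u v\<close> keeps the counterclockwise direction only.\<close>

definition edges :: "('a \<times> 'a) set" where
  "edges = {(u, v). is_vertex u \<and> is_vertex v \<and> vdet u v > 0 \<and>
     (\<forall>y\<in>P. vdet (v - u) y \<ge> vdet v u) \<and>
     (\<forall>y\<in>P. vdet (v - u) y = vdet v u \<longrightarrow> y \<in> conv_hull {u, v})}"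

lemma edgesD:
  assumes "(u, v) \<in> edges"
  shows "is_vertex u" "is_vertex v" "vdet u v > 0"
    "\<And>y. y \<in> P \<Longrightarrow> vdet (v - u) y \<ge> vdet v u"
    "\<And>y. y \<in> P \<Longrightarrow> vdet (v - u) y = vdet v u \<Longrightarrow> y \<in> conv_hull {u, v}"
    "u \<in> P" "v \<in> P" "u \<noteq> v"
  using assms is_vertex_in_P by (auto simp: edges_def vdet_simps)

lemma finite_edges: "finite edges"
  by (rule finite_subset[of _ "S \<times> S"]) (auto simp: edges_def is_vertex_def finite_S)

text \<open>
  Gift wrapping: with \<open>c\<close> supporting at \<open>v\<close>, maximising the ratio of \<open>vdet v s\<close> to
  \<open>vdet c v - vdet c s\<close> tilts the supporting line around \<open>v\<close> until it meets the next vertex.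
\<close>

lemma outgoing_edge:
  assumes "is_vertex v" obtains w where "(v, w) \<in> edges"
proof -
  obtain c where v: "v \<in> S" and c: "\<And>s. s \<in> S - {v} \<Longrightarrow> vdet c s < vdet c v"
    using assms by (auto simp: is_vertex_def)
  define A where "A = S - {v}"
  define q where "q = (\<lambda>s. vdet c v - vdet c s)"
  have q: "q s > 0" if "s \<in> A" for s using c that by (simp add: q_def A_def)
  have finA: "finite A" by (simp add: A_def finite_S)
  \<comment> \<open>A vertex at the origin would make the maximum of \<open>vdet c\<close> over
    \<open>S\<close> equal to 0, against \<open>vdet_pos_exists\<close>.\<close>
  have "v \<noteq> 0"
  proof
    assume "v = 0"
    obtain s where s: "s \<in> S" "vdet b1 s > 0"
      using vdet_pos_exists[of b1] by (auto simp: eq_iff_coords)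
    then have "s \<noteq> v" using \<open>v = 0\<close> by (auto simp: vdet_simps)
    then have "c \<noteq> 0" using c[of s] s(1) by (auto simp: vdet_simps)
    then obtain s' where s': "s' \<in> S" "vdet c s' > 0" by (rule vdet_pos_exists)
    then show False using c[of s'] \<open>v = 0\<close> by (cases "s' = v") (auto simp: vdet_simps)
  qed
  then obtain s0 where "s0 \<in> S" and s0_pos: "vdet v s0 > 0" by (rule vdet_pos_exists)
  then have "s0 \<in> A" by (auto simp: A_def vdet_simps)
  note s0 = this s0_pos
  define r where "r = Max ((\<lambda>s. vdet v s / q s) ` A)"
  have r_ge: "vdet v s / q s \<le> r" if "s \<in> A" for s using that finA by (simp add: r_def)
  have r: "r > 0" using r_ge[OF s0(1)] s0 q[of s0] by (meson divide_pos_pos less_le_trans)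
  define B where "B = {s \<in> A. vdet v s = r * q s}"
  have "r \<in> (\<lambda>s. vdet v s / q s) ` A" unfolding r_def using finA s0 by (intro Max_in) auto
  then have "B \<noteq> {}" using q by (force simp: B_def)
  moreover have "finite B" using finA by (simp add: B_def)
  ultimately have "Max (vdet v ` B) \<in> vdet v ` B" "\<And>s. s \<in> B \<Longrightarrow> vdet v s \<le> Max (vdet v ` B)" by auto
  \<comment> \<open>Several points may come into contact at the same tilt; \<open>w\<close> is the
    one farthest from \<open>v\<close>, so that the segment is the whole edge.\<close>
  then obtain w where w: "w \<in> B" and w_max: "\<And>s. s \<in> B \<Longrightarrow> vdet v s \<le> vdet v w" by auto
  have vw: "vdet v w > 0" using w q r by (auto simp: B_def)
  have B_nonneg: "vdet v s \<ge> 0" if "s \<in> B" for s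
    using that q[of s] r by (simp add: B_def less_imp_le)
  \<comment> \<open>Since \<open>vdet v v = 0\<close>, the inequality
    \<open>vdet e s \<le> vdet e v\<close> unfolds to \<open>vdet v s \<le> r * q s\<close>; for
    \<open>s\<close> in \<open>A\<close>, equality holds exactly on \<open>B\<close>.\<close>
  define e where "e = v + r *s c"
  have e_eq: "vdet e s = vdet e v \<longleftrightarrow> s \<in> B" if "s \<in> A" for s
    using that by (simp add: e_def vdet_simps B_def q_def algebra_simps)
  have e_le: "vdet e s \<le> vdet e v" if "s \<in> S" for s
  proof (cases "s = v")
    case False
    then have s: "s \<in> A" using that by (simp add: A_def)
    have "vdet v s \<le> r * q s" using r_ge[OF s] q[OF s] by (simp add: pos_divide_le_eq)
    then show ?thesis by (simp add: e_def vdet_simps q_def algebra_simps)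
  qed simp
  have face_e: "{s \<in> S. vdet e s = vdet e v} = insert v B"
    using e_eq v by (auto simp: A_def B_def)
  have wS: "w \<in> S" and ew: "vdet e w = vdet e v" using w e_eq by (auto simp: B_def A_def)
  \<comment> \<open>Otherwise \<open>vdet v\<close> would be nonnegative on all of
    \<open>S\<close>.\<close>
  have "e \<noteq> 0"
  proof
    assume "e = 0"
    then have "S = insert v B" using face_e by (auto simp: vdet_simps)
    then have "vdet v s \<ge> 0" if "s \<in> S" for s using that B_nonneg by (auto simp: vdet_simps)
    moreover have "- v \<noteq> 0" using \<open>v \<noteq> 0\<close> by simp
    then obtain s where "s \<in> S" "vdet (- v) s > 0" by (rule vdet_pos_exists)
    ultimately show False by (force simp: vdet_simps)
  qed
  have eP: "vdet e y \<le> vdet e v" if "y \<in> P" for y using e_le that by (rule vdet_le_hull)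
  have ev: "vdet e v > 0" using support_pos[OF \<open>e \<noteq> 0\<close> eP] .
  have "vdet e (w - v) = 0" using ew by (simp add: vdet_simps)
  then obtain k where k: "w - v = k *s e" using vdet_0_parallel[OF \<open>e \<noteq> 0\<close>] by blast
  have kdet: "vdet (w - v) y = k * vdet e y" for y by (simp add: k vdet_simps)
  have wv: "vdet w v = k * vdet e v" using kdet[of v] by (simp add: vdet_simps)
  \<comment> \<open>The negative factor turns the maximum of \<open>vdet e\<close> on
    \<open>P\<close> into the minimum of \<open>vdet (w - v)\<close> demanded by
    \<open>edges\<close>.\<close>
  then have "k < 0" using vw ev vdet_swap[of v w] by (metis neg_0_less_iff_less zero_less_mult_pos2 mult_less_0_iff not_less_iff_gr_or_eq)
  \<comment> \<open>On the supporting line \<open>vdet v\<close> serves as an affine parameter, 0 at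
    \<open>v\<close> and \<open>vdet v w\<close> at \<open>w\<close>.\<close>
  have line: "y = (1 - t) *s v + t *s w" if "vdet e y = vdet e v" and t: "t = vdet v y / vdet v w" for y t
  proof -
    have "vdet e (y - v) = 0" using that by (simp add: vdet_simps)
    then obtain j where j: "y - v = j *s e" using vdet_0_parallel[OF \<open>e \<noteq> 0\<close>] by blast
    then have "y - v = (j / k) *s (w - v)" using k \<open>k < 0\<close> by simp
    then have y: "y = (1 - j / k) *s v + (j / k) *s w" by (simp add: algebra_simps)
    then have "vdet v y = (j / k) * vdet v w" by (simp add: vdet_simps)
    then have "t = j / k" using vw t by simp
    with y show ?thesis by simp
  qed
  have "y \<in> conv_hull {v, w}" if y: "y \<in> P" "vdet e y = vdet e v" for y
  proof -
    have hull: "y \<in> conv_hull (insert v B)"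
      using conv_hull_face[OF linear_vdet e_le y] by (simp add: face_e)
    have "vdet v y \<le> vdet v w"
      by (rule conv_hull_le[OF linear_vdet _ hull]) (use w_max vw in \<open>auto simp: vdet_simps\<close>)
    moreover have "vdet (- v) y \<le> 0"
      by (rule conv_hull_le[OF linear_vdet _ hull])
        (use B_nonneg in \<open>auto simp: vdet_simps\<close>)
    ultimately show ?thesis
      using conv_hull_pairI[of "vdet v y / vdet v w" v w] line[OF y(2) refl] vw by (simp add: vdet_simps)
  qed
  moreover have "is_vertex w"
  proof (rule is_vertex_extreme[of e w v])
    show "vdet e s \<le> vdet e w" if "s \<in> S" for s using e_le[OF that] ew by simp
    show "w \<in> S" by (rule wS)
    fix s assume s: "s \<in> S" "vdet e s = vdet e w" "s \<noteq> w"
    then have eq: "vdet e s = vdet e v" using ew by simp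
    then have "s \<in> insert v B" using face_e s by blast
    then have "vdet v s \<le> vdet v w" using w_max vw by (auto simp: vdet_simps)
    moreover have "vdet v s \<noteq> vdet v w" using line[OF eq refl] s(3) vw by auto
    ultimately show "vdet v s < vdet v w" by simp
  qed
  moreover have "vdet (w - v) y \<ge> vdet w v" if "y \<in> P" for y
    using eP[OF that] \<open>k < 0\<close> by (simp add: kdet wv)
  ultimately have "(v, w) \<in> edges"
    using assms vw \<open>k < 0\<close> by (simp add: edges_def kdet wv)
  then show ?thesis by (rule that)
qed

text \<open>The two left-side conditions make the determinant of \<open>v - x\<close> and
  \<open>w - x\<close> both nonnegative and nonpositive, so the three points are collinear. Each
  head then lies on the segment from \<open>x\<close> to the other one.\<close>

lemma outgoing_edge_unique:
  assumes "(x, v) \<in> edges" "(x, w) \<in> edges" shows "v = w"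
proof -
  note v = edgesD[OF assms(1)] and w = edgesD[OF assms(2)]
  have 0: "vdet (v - x) w = vdet v x" "vdet (w - x) v = vdet w x"
    using v(4)[OF w(7)] w(4)[OF v(7)] by (auto simp: vdet_def algebra_simps)
  obtain t where t: "t \<le> 1" "w = (1 - t) *s x + t *s v" using v(5)[OF w(7) 0(1)] by (rule conv_hull_pairE)
  obtain s where s: "s \<le> 1" "v = (1 - s) *s x + s *s w" using w(5)[OF v(7) 0(2)] by (rule conv_hull_pairE)
  have eq: "vdet x w = t * vdet x v" "vdet x v = s * vdet x w"
    by (subst t(2), simp add: vdet_simps) (subst s(2), simp add: vdet_simps)
  have "t * vdet x v \<le> 1 * vdet x v" "s * vdet x w \<le> 1 * vdet x w"
    using t(1) s(1) v(3) w(3) by (intro mult_right_mono; simp)+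
  then have "vdet x w = vdet x v" using eq by linarith
  then have "t = 1" using eq(1) v(3) by simp
  then show ?thesis using t by simp
qed

lemma incoming_edge_unique:
  assumes "(u, x) \<in> edges" "(w, x) \<in> edges" shows "u = w"
proof -
  note u = edgesD[OF assms(1)] and w = edgesD[OF assms(2)]
  have 0: "vdet (x - u) w = vdet x u" "vdet (x - w) u = vdet x w"
    using u(4)[OF w(6)] w(4)[OF u(6)] by (auto simp: vdet_def algebra_simps)
  obtain t where t: "0 \<le> t" "w = (1 - t) *s u + t *s x" using u(5)[OF w(6) 0(1)] by (rule conv_hull_pairE)
  obtain s where s: "0 \<le> s" "u = (1 - s) *s w + s *s x" using w(5)[OF u(6) 0(2)] by (rule conv_hull_pairE)
  have eq: "vdet w x = (1 - t) * vdet u x" "vdet u x = (1 - s) * vdet w x"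
    by (subst t(2), simp add: vdet_simps) (subst s(2), simp add: vdet_simps)
  have "(1 - t) * vdet u x \<le> 1 * vdet u x" "(1 - s) * vdet w x \<le> 1 * vdet w x"
    using t(1) s(1) u(3) w(3) by (intro mult_right_mono; simp)+
  then have "vdet w x = vdet u x" using eq by linarith
  then have "t = 0" using eq(1) u(3) by simp
  then show ?thesis using t by simp
qed

lemma bij_fst_edges: "bij_betw fst edges {v. is_vertex v}"
  unfolding bij_betw_def
proof
  show "inj_on fst edges" by (auto simp: inj_on_def intro: outgoing_edge_unique)
  have "v \<in> fst ` edges" if v: "is_vertex v" for v
  proof -
    obtain w where "(v, w) \<in> edges" using v by (rule outgoing_edge)
    then show ?thesis by (rule image_eqI[rotated]) simp
  qed
  then show "fst ` edges = {v. is_vertex v}" by (auto dest: edgesD(1))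
qed

text \<open>Surjectivity comes from counting: the tails already show that there are as many edges as
  vertices. This replaces a second gift wrapping in the clockwise direction.\<close>

lemma bij_snd_edges: "bij_betw snd edges {v. is_vertex v}"
  unfolding bij_betw_def
proof
  show inj: "inj_on snd edges" by (auto simp: inj_on_def intro: incoming_edge_unique)
  have "card (snd ` edges) = card {v. is_vertex v}"
    using card_image[OF inj] bij_betw_same_card[OF bij_fst_edges] by simp
  moreover have "snd ` edges \<subseteq> {v. is_vertex v}" by (auto dest: edgesD(2))
  moreover have "finite {v. is_vertex v}" by (rule finite_subset[OF _ finite_S]) (auto simp: is_vertex_def)
  ultimately show "snd ` edges = {v. is_vertex v}" by (intro card_subset_eq) auto
qed

lemma incoming_edge:
  assumes "is_vertex v" obtains u where "(u, v) \<in> edges"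
proof -
  have "v \<in> snd ` edges" using assms bij_snd_edges by (simp add: bij_betw_def)
  then show ?thesis using that by auto
qed

end


section \<open>Heights along the boundary\<close>

context polygon
begin

text \<open>Cramer's coefficients are quotients of determinants whose signs are the left-side
  conditions of the two edges at \<open>x\<close>. This turns comparisons with the two neighbours of
  \<open>x\<close> into comparisons with all of \<open>P\<close>.\<close>

lemma cone_at_vertex:
  assumes ux: "(u, x) \<in> edges" and xv: "(x, v) \<in> edges" and y: "y \<in> P"
  obtains a b where "0 \<le> a" "0 \<le> b" "y - x = a *s (v - x) + b *s (u - x)"
proof -
  note u = edgesD[OF ux] and v = edgesD[OF xv]
  \<comment> \<open>Were the two edges collinear, \<open>v\<close> would lie on the segment from
    \<open>u\<close> to \<open>x\<close>, hence clockwise from \<open>x\<close> or at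
    \<open>x\<close>.\<close>
  have "vdet (v - x) (u - x) \<noteq> 0"
  proof
    assume "vdet (v - x) (u - x) = 0"
    then have "vdet (x - u) v = vdet x u" by (simp add: vdet_def algebra_simps)
    with u(5) v(7) have "v \<in> conv_hull {u, x}" by blast
    then obtain t where t: "t \<le> 1" "v = (1 - t) *s u + t *s x" by (rule conv_hull_pairE)
    have "vdet x v = (1 - t) * vdet x u" by (subst t(2)) (simp add: vdet_simps)
    moreover have "\<dots> \<le> 0" using t(1) u(3) vdet_swap[of x u] by (intro mult_nonneg_nonpos) auto
    ultimately show False using v(3) by simp
  qed
  moreover have "vdet (v - x) (u - x) \<ge> 0"
    using u(4)[OF v(7)] by (simp add: vdet_def algebra_simps)
  ultimately have pos: "vdet (v - x) (u - x) > 0" by simp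
  have "vdet (y - x) (u - x) \<ge> 0" using u(4)[OF y] by (simp add: vdet_def algebra_simps)
  moreover have "vdet (v - x) (y - x) \<ge> 0" using v(4)[OF y] by (simp add: vdet_def algebra_simps)
  ultimately show ?thesis
    using pos by (intro that[OF _ _ vdet_cramer[of "v - x" "u - x" "y - x"]]) auto
qed

text \<open>\<open>f y - f x\<close> is a nonnegative combination of the nonpositive differences at
  the two neighbours. The strict one, at \<open>u\<close>, must have coefficient 0 on a tie, so ties
  lie towards \<open>v\<close>, counterclockwise from \<open>x\<close>; two such maxima would
  contradict the antisymmetry of \<open>vdet\<close>.\<close>

lemma local_max_is_max:
  assumes f: "Vector_Spaces.linear scale (*) f"
    and ux: "(u, x) \<in> edges" "f u < f x" and xv: "(x, v) \<in> edges" "f v \<le> f x" and y: "y \<in> P"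
  shows "f y \<le> f x" "f y = f x \<Longrightarrow> y \<noteq> x \<Longrightarrow> vdet x y > 0"
proof -
  note lin = linear_functional_comb[OF f]
  obtain a b where ab: "0 \<le> a" "0 \<le> b" and yx: "y - x = a *s (v - x) + b *s (u - x)"
    using ux(1) xv(1) y by (rule cone_at_vertex)
  have fy: "f y - f x = a * (f v - f x) + b * (f u - f x)"
    using arg_cong[OF yx, of f] by (simp only: lin)
  have nonpos: "a * (f v - f x) \<le> 0" "b * (f u - f x) \<le> 0"
    using ab ux xv by (auto intro: mult_nonneg_nonpos)
  then show "f y \<le> f x" using fy by simp
  assume "f y = f x" "y \<noteq> x"
  then have "b * (f u - f x) = 0" using fy nonpos by linarith
  then have "b = 0" using ux by auto
  then have y_eq: "y = x + a *s (v - x)" using yx by (simp add: algebra_simps)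
  then have "a \<noteq> 0" using \<open>y \<noteq> x\<close> by auto
  then show "vdet x y > 0"
    using ab edgesD(3)[OF xv(1)] by (simp add: y_eq vdet_simps)
qed

text \<open>Here the outgoing edge is the strict one, so ties lie towards \<open>u\<close>,
  clockwise from \<open>x\<close>.\<close>

lemma local_min_is_min:
  assumes f: "Vector_Spaces.linear scale (*) f"
    and ux: "(u, x) \<in> edges" "f x \<le> f u" and xv: "(x, v) \<in> edges" "f x < f v" and y: "y \<in> P"
  shows "f x \<le> f y" "f y = f x \<Longrightarrow> y \<noteq> x \<Longrightarrow> vdet y x > 0"
proof -
  note lin = linear_functional_comb[OF f]
  obtain a b where ab: "0 \<le> a" "0 \<le> b" and yx: "y - x = a *s (v - x) + b *s (u - x)"
    using ux(1) xv(1) y by (rule cone_at_vertex)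
  have fy: "f y - f x = a * (f v - f x) + b * (f u - f x)"
    using arg_cong[OF yx, of f] by (simp only: lin)
  have nonneg: "a * (f v - f x) \<ge> 0" "b * (f u - f x) \<ge> 0"
    using ab ux xv by auto
  then show "f x \<le> f y" using fy by simp
  assume "f y = f x" "y \<noteq> x"
  then have "a * (f v - f x) = 0" using fy nonneg by linarith
  then have "a = 0" using xv by auto
  then have y_eq: "y = x + b *s (u - x)" using yx by (simp add: algebra_simps)
  then have "b \<noteq> 0" using \<open>y \<noteq> x\<close> by auto
  then show "vdet y x > 0"
    using ab edgesD(3)[OF ux(1)] by (simp add: y_eq vdet_simps)
qed

text \<open>Take \<open>v\<close> to be the clockwise end of the face. The other points of the face
  are \<open>v - t *s c\<close> with \<open>t \<ge> 0\<close>; since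
  \<open>vdet c w \<le> h\<close>, they cannot lie strictly to the left of the edge leaving
  \<open>v\<close>, so they lie on it.\<close>

lemma supporting_edge:
  assumes c: "c \<noteq> 0" and le: "\<And>y. y \<in> P \<Longrightarrow> vdet c y \<le> h" and attained: "\<exists>y\<in>P. vdet c y = h"
  obtains v w where "(v, w) \<in> edges" "\<And>y. y \<in> P \<Longrightarrow> vdet c y = h \<Longrightarrow> y \<in> conv_hull {v, w}"
proof -
  define F where "F = {s \<in> S. vdet c s = h}"
  have leS: "vdet c s \<le> h" if "s \<in> S" for s using that le conv_hull_subset by blast
  have hull: "y \<in> conv_hull F" if "y \<in> P" "vdet c y = h" for y
    using conv_hull_face[OF linear_vdet leS that] by (simp add: F_def)
  then have "conv_hull F \<noteq> {}" using attained by blast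
  moreover have "conv_hull {} = {}" by (simp add: conv_hull_def)
  ultimately have F: "F \<noteq> {}" by metis
  have finF: "finite F" using finite_S by (simp add: F_def)
  have "- c \<noteq> 0" using c by simp
  then obtain d where "vdet (- c) d > 0" by (rule vdet_pos_exists)
  \<comment> \<open>\<open>vdet d\<close> serves to order the points of the supporting line, whose
    direction is \<open>c\<close>; it decreases along \<open>- c\<close>.\<close>
  then have d: "vdet d c > 0" using vdet_swap[of d c] by (simp add: vdet_simps)
  have "Max (vdet d ` F) \<in> vdet d ` F" using F finF by (intro Max_in) auto
  then obtain v where v: "v \<in> F" "vdet d v = Max (vdet d ` F)" by auto
  have vS: "v \<in> S" and cv: "vdet c v = h" using v(1) by (auto simp: F_def)
  have maxF: "vdet d s \<le> vdet d v" if "s \<in> F" for s using that finF v(2) by simp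
  have line: "\<exists>t\<ge>0. y = v - t *s c" if y: "vdet c y = h" "vdet d y \<le> vdet d v" for y
  proof -
    have "vdet c (v - y) = 0" using y cv by (simp add: vdet_simps)
    then obtain t where t: "v - y = t *s c" using vdet_0_parallel[OF c] by blast
    then have y_eq: "y = v - t *s c" by (simp add: t[symmetric])
    then have "t * vdet d c \<ge> 0" using y(2) by (simp add: vdet_simps)
    then have "t \<ge> 0" using d by (simp add: zero_le_mult_iff)
    then show ?thesis using y_eq by blast
  qed
  have "is_vertex v"
  proof (rule is_vertex_extreme[of c v d])
    show "vdet c s \<le> vdet c v" if "s \<in> S" for s using leS[OF that] cv by simp
    show "v \<in> S" by (rule vS)
    fix s assume s: "s \<in> S" "vdet c s = vdet c v" "s \<noteq> v"
    then have sF: "vdet d s \<le> vdet d v" using maxF cv by (simp add: F_def)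
    then obtain t where t: "t \<ge> 0" "s = v - t *s c" using line s cv by auto
    then have "t \<noteq> 0" using s by auto
    then show "vdet d s < vdet d v" using t d by (simp add: vdet_simps)
  qed
  then obtain w where vw: "(v, w) \<in> edges" by (rule outgoing_edge)
  note e = edgesD[OF vw]
  have "y \<in> conv_hull {v, w}" if y: "y \<in> P" "vdet c y = h" for y
  proof -
    have "vdet d y \<le> vdet d v" using maxF hull[OF y] by (rule conv_hull_le[OF linear_vdet])
    then obtain t where t: "t \<ge> 0" "y = v - t *s c" using line y by auto
    have "vdet (w - v) y = vdet w v + t * (vdet c w - vdet c v)"
      by (simp add: t(2) vdet_def algebra_simps)
    also have "\<dots> \<le> vdet w v" using t(1) le[OF e(7)] cv by (simp add: mult_nonneg_nonpos)
    finally show ?thesis using e(4,5)[OF y(1)] by simp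
  qed
  with vw show ?thesis by (rule that)
qed

lemma edges_nonempty: "edges \<noteq> {}"
proof -
  have b1: "b1 \<noteq> 0" by (simp add: eq_iff_coords)
  then obtain s where "s \<in> S" by (rule vdet_pos_exists)
  define h where "h = Max (vdet b1 ` S)"
  have "h \<in> vdet b1 ` S" unfolding h_def using finite_S \<open>s \<in> S\<close> by (intro Max_in) auto
  then have "\<exists>y\<in>P. vdet b1 y = h" using conv_hull_subset by auto
  moreover have "vdet b1 y \<le> h" if "y \<in> P" for y
    by (rule vdet_le_hull[OF _ that]) (simp add: h_def finite_S)
  ultimately show ?thesis using supporting_edge[OF b1, of h] by blast
qed

text \<open>
  The edges along which \<open>f\<close> increases form a chain: a vertex that is the head but not the tail of
  one of them is a maximum of \<open>f\<close> on \<open>P\<close>, and there is only one such vertex as the edges are oriented.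
\<close>

lemma sum_increasing_edges:
  assumes f: "Vector_Spaces.linear scale (*) f"
  obtains p q where "p \<in> P" "q \<in> P" "\<forall>y\<in>P. f q \<le> f y \<and> f y \<le> f p"
    "(\<Sum>(u, v)\<in>edges. max 0 (f (v - u))) = f p - f q"
    "(\<Sum>(u, v)\<in>edges. max 0 (f (u - v))) = f p - f q"
proof -
  note lin = linear_functional_comb[OF f]
  define U where "U = {e \<in> edges. f (fst e) < f (snd e)}"
  have U_sub: "U \<subseteq> edges" and finU: "finite U" using finite_edges by (auto simp: U_def)
  define H where "H = snd ` U"
  define T where "T = fst ` U"
  have inj: "inj_on fst U" "inj_on snd U"
    using bij_fst_edges bij_snd_edges U_sub by (auto simp: bij_betw_def intro: inj_on_subset)
  have fin: "finite H" "finite T" using finU by (auto simp: H_def T_def)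
  have card_HT: "card H = card T" using inj by (simp add: H_def T_def card_image)
  have total: "(\<Sum>e\<in>edges. f (snd e)) = (\<Sum>e\<in>edges. f (fst e))"
    using sum.reindex_bij_betw[OF bij_fst_edges, of f] sum.reindex_bij_betw[OF bij_snd_edges, of f]
    by (simp add: o_def)
  have "(\<Sum>e\<in>edges. max 0 (f (snd e) - f (fst e))) - (\<Sum>e\<in>edges. max 0 (f (fst e) - f (snd e)))
      = (\<Sum>e\<in>edges. f (snd e) - f (fst e))"
    unfolding sum_subtractf[symmetric] by (rule sum.cong) auto
  also have "\<dots> = 0" using total by (simp add: sum_subtractf)
  finally have down: "(\<Sum>e\<in>edges. max 0 (f (fst e) - f (snd e))) = (\<Sum>e\<in>edges. max 0 (f (snd e) - f (fst e)))"
    by simp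
  have up: "(\<Sum>e\<in>edges. max 0 (f (snd e) - f (fst e))) = (\<Sum>e\<in>U. f (snd e) - f (fst e))"
    by (rule sum.mono_neutral_cong_right[OF finite_edges U_sub]) (auto simp: U_def)
  have concl: "(\<Sum>(u, v)\<in>edges. max 0 (f (v - u))) = (\<Sum>e\<in>U. f (snd e) - f (fst e))"
    "(\<Sum>(u, v)\<in>edges. max 0 (f (u - v))) = (\<Sum>e\<in>U. f (snd e) - f (fst e))"
    using up down by (simp_all add: lin case_prod_beta)
  show ?thesis
  proof (cases "U = {}")
    \<comment> \<open>Gains and losses agree, so without an increasing edge there is no decreasing
      one. Then \<open>f\<close> is constant on \<open>P\<close> and one vertex serves as maximum
      and minimum.\<close>
    case True
    then have "\<forall>e\<in>edges. max 0 (f (fst e) - f (snd e)) = 0"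
      using up down finite_edges by (subst sum_nonneg_eq_0_iff[symmetric]) auto
    then have le: "f u \<le> f v" if "(u, v) \<in> edges" for u v using that by force
    have flat: "f u = f v" if "(u, v) \<in> edges" for u v
      using le[OF that] that True by (force simp: U_def)
    obtain x v where xv: "(x, v) \<in> edges" using edges_nonempty by auto
    obtain u where ux: "(u, x) \<in> edges" using edgesD(1)[OF xv] by (rule incoming_edge)
    have const: "f y = f x" if y: "y \<in> P" for y
    proof -
      obtain a b where yx: "y - x = a *s (v - x) + b *s (u - x)"
        using ux xv y by (rule cone_at_vertex)
      have "f y - f x = a * (f v - f x) + b * (f u - f x)"
        using arg_cong[OF yx, of f] by (simp only: lin)
      then show ?thesis using flat[OF ux] flat[OF xv] by simp
    qed
    show ?thesis
    proof (rule that)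
      show "x \<in> P" "x \<in> P" using edgesD(6)[OF xv] by simp_all
      show "\<forall>y\<in>P. f x \<le> f y \<and> f y \<le> f x" using const by (intro ballI) (metis order_refl)
    qed (use concl True in simp_all)
  next
    case False
    have gain: "(\<Sum>e\<in>U. f (snd e) - f (fst e)) = sum f (H - T) - sum f (T - H)"
    proof -
      have "(\<Sum>e\<in>U. f (snd e) - f (fst e)) = sum f H - sum f T"
        using inj by (simp add: sum_subtractf H_def T_def sum.reindex)
      also have "\<dots> = sum f (H - T) - sum f (T - H)"
        using sum.Int_Diff[OF fin(1), of f T] sum.Int_Diff[OF fin(2), of f H] by (simp add: Int_commute)
      finally show ?thesis .
    qed
    have "(\<Sum>e\<in>U. f (snd e) - f (fst e)) > 0"
      using False finU by (intro sum_pos) (auto simp: U_def)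
    then have ne: "H - T \<noteq> {} \<or> T - H \<noteq> {}" using gain by force
    \<comment> \<open>\<open>H\<close> and \<open>T\<close> have equal size, hence so have the two
      differences. A positive gain excludes that both are empty, so neither is.\<close>
    have "card (H - T) = card (T - H)"
      using card_HT fin by (simp add: card_Diff_subset_Int Int_commute)
    then have ne: "H - T \<noteq> {}" "T - H \<noteq> {}" using ne fin by (metis card_eq_0_iff finite_Diff)+
    have top: "x \<in> P \<and> (\<forall>y\<in>P. f y \<le> f x \<and> (f y = f x \<longrightarrow> y \<noteq> x \<longrightarrow> vdet x y > 0))"
      if x: "x \<in> H - T" for x
    proof -
      obtain u where ux: "(u, x) \<in> edges" "f u < f x" using x by (auto simp: H_def U_def)
      obtain v where xv: "(x, v) \<in> edges" using edgesD(2)[OF ux(1)] by (rule outgoing_edge)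
      have "f v \<le> f x" using x xv by (force simp: T_def U_def)
      then show ?thesis using local_max_is_max[OF f ux xv] edgesD(6)[OF xv] by blast
    qed
    have bot: "x \<in> P \<and> (\<forall>y\<in>P. f x \<le> f y \<and> (f y = f x \<longrightarrow> y \<noteq> x \<longrightarrow> vdet y x > 0))"
      if x: "x \<in> T - H" for x
    proof -
      obtain v where xv: "(x, v) \<in> edges" "f x < f v" using x by (auto simp: T_def U_def)
      obtain u where ux: "(u, x) \<in> edges" using edgesD(1)[OF xv(1)] by (rule incoming_edge)
      have "f x \<le> f u" using x ux by (force simp: H_def U_def)
      then show ?thesis using local_min_is_min[OF f ux _ xv] edgesD(6)[OF xv(1)] by blast
    qed
    obtain p where p: "p \<in> H - T" using ne by auto
    obtain q where q: "q \<in> T - H" using ne by auto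
    have "x = p" if "x \<in> H - T" for x
      using top[OF that] top[OF p] vdet_swap[of x p] by (metis dual_order.antisym neg_0_less_iff_less not_less_iff_gr_or_eq)
    then have "H - T = {p}" using p by blast
    moreover have "x = q" if "x \<in> T - H" for x
      using bot[OF that] bot[OF q] vdet_swap[of x q] by (metis dual_order.antisym neg_0_less_iff_less not_less_iff_gr_or_eq)
    then have "T - H = {q}" using q by blast
    ultimately have "(\<Sum>e\<in>U. f (snd e) - f (fst e)) = f p - f q" using gain by simp
    then show ?thesis using top[OF p] bot[OF q] concl by (intro that[of p q]) auto
  qed
qed

end


section \<open>Invariants of lattice cones\<close>

context lattice_frame
begin

lemma independent_pair_iff:
  assumes "u \<noteq> v" shows "independent {u, v} \<longleftrightarrow> vdet u v \<noteq> 0"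
proof
  assume ind: "independent {u, v}"
  show "vdet u v \<noteq> 0"
  proof
    assume 0: "vdet u v = 0"
    have "u \<noteq> 0" using ind dependent_zero by auto
    then obtain t where "v = t *s u" using 0 by (rule vdet_0_parallel)
    then have "v \<in> span {u}" using span_base[of u "{u}"] span_scale by auto
    moreover have "{v, u} = {u, v}" by auto
    ultimately show False using ind assms independent_insert[of v "{u}"] by auto
  qed
next
  assume "vdet u v \<noteq> 0"
  then have "v \<noteq> 0" "u \<notin> span {v}" by (auto simp: span_singleton vdet_simps)
  then show "independent {u, v}" using independent_insert[of u "{v}"] assms by auto
qed

section \<open>Primitive vectors of \<open>N\<close> and of \<open>M\<close>\<close>

lemma N_closed: "a \<in> N \<Longrightarrow> b \<in> N \<Longrightarrow> of_int i *s a + of_int j *s b \<in> N"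
  by (simp add: mem_N_iff)

lemma primitive_N_D:
  assumes "primitive_N x" shows "x \<in> N" "x \<noteq> 0"
proof -
  show N: "x \<in> N" using assms by (simp add: primitive_N_def primitive_def)
  show "x \<noteq> 0"
  proof
    assume "x = 0"
    then have "x \<in> N \<and> x = of_nat 2 *s x" using N by simp
    then have "(2::nat) = 1" using assms unfolding primitive_N_def primitive_def by blast
    then show False by simp
  qed
qed

text \<open>Write \<open>r = p / q\<close> in lowest terms with \<open>s * p + t * q = 1\<close>.
  Then \<open>d\<close> divided by \<open>q\<close> equals \<open>s\<close> times
  \<open>r *s d\<close> plus \<open>t\<close> times \<open>d\<close>, which is in \<open>N\<close>,
  and primitivity forces \<open>q = 1\<close>.\<close>

lemma primitive_N_multiple_Ints:
  assumes d: "primitive_N d" and rd: "r *s d \<in> N" shows "r \<in> \<int>"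
proof -
  obtain p q where pq: "quotient_of r = (p, q)" by fastforce
  then have q: "q > 0" and co: "coprime p q" and r_eq: "r = of_int p / of_int q"
    using quotient_of_denom_pos quotient_of_coprime quotient_of_div by blast+
  obtain s t where st: "s * p + t * q = 1"
    using co bezout_int[of p q] by (auto simp: coprime_iff_gcd_eq_1)
  define z where "z = (1 / of_int q) *s d"
  have "of_int s *s (r *s d) + of_int t *s d = (of_int s * r + of_int t) *s d"
    by (simp add: scale_left_distrib)
  also have "of_int s * r + of_int t = (of_int (s * p + t * q) :: rat) * (1 / of_int q)"
    using q by (simp add: r_eq field_simps)
  finally have "z = of_int s *s (r *s d) + of_int t *s d" using st by (simp add: z_def)
  then have z: "z \<in> N" using N_closed[OF rd primitive_N_D(1)[OF d]] by metis
  have "d = of_nat (nat q) *s z" using q by (simp add: z_def)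
  then have "nat q = 1" using d z unfolding primitive_N_def primitive_def by blast
  then have "q = 1" using q by (simp add: nat_eq_iff)
  then show ?thesis by (simp add: r_eq)
qed

text \<open>Both \<open>r\<close> and \<open>1 / r\<close> are integers, so a ray carries at most
  one primitive vector.\<close>

lemma primitive_N_pos_multiple_eq:
  assumes x: "primitive_N x" and y: "primitive_N y" and r: "r \<ge> 0" and xy: "x = r *s y"
  shows "x = y"
proof -
  have pos: "r > 0" using primitive_N_D(2)[OF x] xy r by (cases "r = 0") auto
  then have yx: "y = (1 / r) *s x" by (simp add: xy)
  have "r \<in> \<int>" using primitive_N_multiple_Ints[OF y] primitive_N_D(1)[OF x] xy by simp
  moreover have "1 / r \<in> \<int>" using primitive_N_multiple_Ints[OF x] primitive_N_D(1)[OF y] yx by simp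
  ultimately obtain i j :: int where ij: "r = of_int i" "1 / r = of_int j" by (auto elim!: Ints_cases)
  then have "of_int (i * j) = (1::rat)" using pos by (metis nonzero_mult_div_cancel_left of_int_mult times_divide_eq_right mult_1_right less_irrefl)
  then have "i * j = 1" by (simp only: of_int_eq_1_iff)
  then have "r = 1" using pos ij(1) zmult_eq_1_iff by auto
  then show ?thesis by (simp add: xy)
qed

lemma primitive_direction:
  assumes "x \<in> N" "x \<noteq> 0"
  obtains g d where "g > 0" "primitive_N d" "x = of_nat g *s d"
proof -
  obtain i j :: int where ij: "coord1 x = of_int i" "coord2 x = of_int j"
    using assms(1) by (auto simp: mem_N_iff elim!: Ints_cases)
  have ne: "i \<noteq> 0 \<or> j \<noteq> 0" using assms(2) ij by (auto simp: eq_iff_coords)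
  define g where "g = gcd i j"
  have g: "g > 0" using ne by (simp add: g_def)
  obtain i' j' where i': "i = g * i'" and j': "j = g * j'"
    unfolding g_def by (meson gcd_dvd1 gcd_dvd2 dvdE)
  have co: "coprime i' j'"
    using ne gcd_mult_distrib_int[of g i' j'] g i' j' by (metis abs_of_pos g_def coprime_iff_gcd_eq_1 mult_cancel_left1 less_irrefl)
  define d where "d = of_int i' *s b1 + of_int j' *s b2"
  have d: "coord1 d = of_int i'" "coord2 d = of_int j'" by (simp_all add: d_def)
  have "primitive_N d" unfolding primitive_N_def primitive_def
  proof (intro conjI allI impI)
    show "d \<in> N" by (simp add: mem_N_iff d)
    fix k :: nat and y assume y: "y \<in> N \<and> d = of_nat k *s y"
    then obtain p q :: int where pq: "coord1 y = of_int p" "coord2 y = of_int q"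
      by (auto simp: mem_N_iff elim!: Ints_cases)
    have "of_int i' = (of_int (int k * p) :: rat)" "of_int j' = (of_int (int k * q) :: rat)"
      using y d pq by simp_all
    then have "i' = int k * p" "j' = int k * q" by (simp_all only: of_int_eq_iff)
    then have "int k dvd 1" using co by (metis coprime_common_divisor dvd_triv_left)
    then show "k = 1" by simp
  qed
  moreover have "x = of_nat (nat g) *s d"
    using g by (simp add: eq_iff_coords ij d i' j')
  ultimately show ?thesis using g by (intro that[of "nat g" d]) auto
qed

lemma vdet_inject:
  assumes "vdet c = vdet d" shows "c = d"
  using fun_cong[OF assms, of b1] fun_cong[OF assms, of b2] by (simp add: vdet_def eq_iff_coords)

lemma M_D:
  assumes "m \<in> M"
  shows "Vector_Spaces.linear scale (*) m" "x \<in> N \<Longrightarrow> m x \<in> \<int>"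
  using assms by (auto simp: M_def)

text \<open>By unimodularity \<open>vdet c\<close> is in \<open>M\<close> exactly when
  \<open>c\<close> is in \<open>N\<close>, so divisibility is the same on both sides.\<close>

lemma primitive_M_vdet_iff: "primitive_M (vdet d) \<longleftrightarrow> primitive_N d"
proof -
  have vdet_M: "vdet c \<in> M" if "c \<in> N" for c
    using linear_vdet that by (auto simp: M_def vdet_def mem_N_iff)
  have N_vdet: "c \<in> N" if "vdet c \<in> M" for c
    using M_D(2)[OF that, of b1] M_D(2)[OF that, of b2] lattice_basis_mem[OF frame_basis]
    by (simp add: mem_N_iff vdet_def minus_in_Ints_iff)
  show ?thesis
  proof
    assume d: "primitive_M (vdet d)"
    show "primitive_N d" unfolding primitive_N_def primitive_def
    proof (intro conjI allI impI)
      show "d \<in> N" using d N_vdet by (simp add: primitive_M_def primitive_def)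
      fix k :: nat and y assume y: "y \<in> N \<and> d = of_nat k *s y"
      then have "vdet d = (\<lambda>x. of_nat k * vdet y x)" by (auto simp: vdet_simps)
      then show "k = 1" using d y vdet_M unfolding primitive_M_def primitive_def by blast
    qed
  next
    assume d: "primitive_N d"
    show "primitive_M (vdet d)" unfolding primitive_M_def primitive_def
    proof (intro conjI allI impI)
      show "vdet d \<in> M" by (rule vdet_M[OF primitive_N_D(1)[OF d]])
      fix k :: nat and m assume m: "m \<in> M \<and> vdet d = (\<lambda>x. of_nat k * m x)"
      define c where "c = m b2 *s b1 - m b1 *s b2"
      have mc: "m = vdet c" using linear_functional_eq_vdet[OF M_D(1)] m by (auto simp: c_def)
      then have "vdet d = vdet (of_nat k *s c)" using m by (auto simp: vdet_simps)
      then have "d = of_nat k *s c" by (rule vdet_inject)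
      moreover have "c \<in> N" using N_vdet m mc by simp
      ultimately show "k = 1" using d unfolding primitive_N_def primitive_def by blast
    qed
  qed
qed

lemma primitive_M_cases:
  assumes "primitive_M m" obtains c where "primitive_N c" "m = vdet c"
proof -
  define c where "c = m b2 *s b1 - m b1 *s b2"
  have "m \<in> M" using assms by (simp add: primitive_M_def primitive_def)
  then have "m = vdet c" using linear_functional_eq_vdet[OF M_D(1)] by (auto simp: c_def)
  then show ?thesis using assms that primitive_M_vdet_iff by simp
qed

section \<open>Uniqueness behind the generators, the inner normal and the width\<close>

lemma cone_generator_unique:
  assumes eq: "cone_hull {u', v'} = cone_hull {u, v}"
    and ne: "u \<noteq> v" "u' \<noteq> v'" and det: "vdet u' v' \<noteq> 0"
    and prim: "primitive_N u" "primitive_N v" "primitive_N u'"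
  shows "u' \<in> {u, v}"
proof -
  have mem: "w \<in> cone_hull {w, z}" "z \<in> cone_hull {w, z}" if "w \<noteq> z" for w z
    using cone_hull_pairI[of 1 0 w z] cone_hull_pairI[of 0 1 w z] that by auto
  obtain a b where ab: "u' = a *s u + b *s v" "0 \<le> a" "0 \<le> b"
    using mem(1)[OF ne(2)] by (auto simp: eq cone_hull_pair[OF ne(1)])
  obtain a' b' where u: "u = a' *s u' + b' *s v'" "0 \<le> a'" "0 \<le> b'"
    using mem(1)[OF ne(1)] by (auto simp: eq[symmetric] cone_hull_pair[OF ne(2)])
  obtain c' d' where v: "v = c' *s u' + d' *s v'" "0 \<le> c'" "0 \<le> d'"
    using mem(2)[OF ne(1)] by (auto simp: eq[symmetric] cone_hull_pair[OF ne(2)])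
  \<comment> \<open>Pairing with \<open>u'\<close> isolates the coefficient of \<open>v'\<close> in
    \<open>u'\<close>. It is a sum of nonnegative products, so whichever of \<open>u\<close> and
    \<open>v\<close> occurs in \<open>u'\<close> lies on the ray of \<open>u'\<close>.\<close>
  have "0 = vdet u' (a *s u + b *s v)" using ab(1) by (simp add: vdet_simps)
  also have "\<dots> = (a * b' + b * d') * vdet u' v'"
    by (simp add: vdet_simps u(1) v(1) algebra_simps)
  finally have "a * b' + b * d' = 0" using det by simp
  then have 0: "a * b' = 0" "b * d' = 0" using ab u v by (simp_all add: add_nonneg_eq_0_iff)
  show ?thesis
  proof (cases "a = 0")
    case False
    then have "u = a' *s u'" using 0 u by simp
    then show ?thesis using primitive_N_pos_multiple_eq[OF prim(1,3) u(2)] by simp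
  next
    case True
    then have "b \<noteq> 0" using ab primitive_N_D(2)[OF prim(3)] by auto
    then have "v = c' *s u'" using 0 v by simp
    then show ?thesis using primitive_N_pos_multiple_eq[OF prim(2,3) v(2)] by simp
  qed
qed

lemma prim_gens_cone_hull:
  assumes det: "vdet u v \<noteq> 0" and prim: "primitive_N u" "primitive_N v"
  shows "prim_gens (cone_hull {u, v}) = {u, v}"
proof -
  have ne: "u \<noteq> v" using det by (auto simp: vdet_simps)
  show ?thesis unfolding prim_gens_def
  proof (rule the_equality)
    show "\<exists>u' v'. {u, v} = {u', v'} \<and> u' \<noteq> v' \<and> independent {u', v'} \<and>
      primitive_N u' \<and> primitive_N v' \<and> cone_hull {u, v} = cone_hull {u', v'}"
      using ne det prim independent_pair_iff[OF ne] by (intro exI[of _ u] exI[of _ v]) simp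
    fix G assume "\<exists>u' v'. G = {u', v'} \<and> u' \<noteq> v' \<and> independent {u', v'} \<and>
      primitive_N u' \<and> primitive_N v' \<and> cone_hull {u, v} = cone_hull {u', v'}"
    then obtain u' v' where G: "G = {u', v'}" "u' \<noteq> v'" "independent {u', v'}"
      "primitive_N u'" "primitive_N v'" "cone_hull {u', v'} = cone_hull {u, v}" by metis
    have det': "vdet u' v' \<noteq> 0" using G(3) independent_pair_iff[OF G(2)] by simp
    then have swap: "vdet v' u' \<noteq> 0" "vdet v u \<noteq> 0" using det vdet_swap[of v' u'] vdet_swap[of v u] by auto
    have "u' \<in> {u, v}" using cone_generator_unique[OF G(6) ne G(2) det' prim G(4)] .
    moreover have "v' \<in> {u, v}"
      using cone_generator_unique[OF _ ne G(2)[symmetric] swap(1) prim G(5)] G(6)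
      by (simp add: insert_commute)
    ultimately show "G = {u, v}" using G(1,2) by auto
  qed
qed

text \<open>The values at \<open>u\<close> and \<open>v\<close> determine a functional, so two
  candidates differ by a positive factor, which primitivity makes 1. The sign of
  \<open>vdet u v\<close> is left open because the generators of a subcone come in no particular
  order.\<close>

lemma inner_normal_eqI:
  assumes gens: "prim_gens \<sigma> = {u, v}" and det: "vdet u v \<noteq> 0"
    and m: "primitive_M m" "m u < 0" "m u = m v"
  shows "inner_normal \<sigma> = m"
  unfolding inner_normal_def gens
proof (rule the_equality)
  show "primitive_M m \<and> (\<exists>l<0. \<forall>u\<in>{u, v}. m u = l)" using m by auto
  fix m' assume m': "primitive_M m' \<and> (\<exists>l<0. \<forall>u\<in>{u, v}. m' u = l)"
  then obtain l where l: "l < 0" "m' u = l" "m' v = l" by auto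
  obtain c where c: "primitive_N c" "m = vdet c" using m(1) by (rule primitive_M_cases)
  have "primitive_M m'" using m' by blast
  then obtain c' where c': "primitive_N c'" "m' = vdet c'" by (rule primitive_M_cases)
  define r where "r = l / m u"
  have r: "r \<ge> 0" using l m by (simp add: r_def divide_nonpos_nonpos)
  have "vdet c' x = vdet (r *s c) x" for x
  proof -
    obtain p q where x: "x = p *s u + q *s v" using vdet_cramer[OF det] by blast
    show ?thesis using l m c(2) c'(2) by (simp add: x vdet_simps r_def field_simps)
  qed
  then have "c' = r *s c" by (intro vdet_inject) auto
  then show "m' = m" using primitive_N_pos_multiple_eq[OF c'(1) c(1) r] c c' by simp
qed

text \<open>The lattice points of the segment are \<open>u\<close> plus \<open>k\<close> times
  \<open>d\<close> for \<open>k\<close> from 0 to \<open>g\<close>; the \<open>- 1\<close> in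
  \<open>width\<close> corrects the count \<open>g + 1\<close>.\<close>

lemma width_eqI:
  assumes gens: "prim_gens \<sigma> = {u, v}" and u: "u \<in> N"
    and d: "primitive_N d" "v - u = of_nat g *s d"
  shows "width \<sigma> = g"
proof -
  have inj: "r = s" if "u + r *s d = u + s *s d" for r s
    using that primitive_N_D(2)[OF d(1)] by simp
  have "conv_hull {u, v} \<inter> N = (\<lambda>k. u + of_nat k *s d) ` {0..g}"
  proof (intro equalityI subsetI)
    fix y assume y: "y \<in> conv_hull {u, v} \<inter> N"
    then obtain t where t: "0 \<le> t" "t \<le> 1" "y = (1 - t) *s u + t *s v" by (blast elim: conv_hull_pairE)
    have "y - u = t *s (v - u)" by (simp add: t(3) algebra_simps)
    then have yd: "y - u = (t * of_nat g) *s d" by (simp add: d(2))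
    have "y - u \<in> N" using y u by (auto simp: mem_N_iff)
    then have "t * of_nat g \<in> \<int>" using primitive_N_multiple_Ints[OF d(1)] yd by simp
    then obtain i :: int where i: "t * of_nat g = of_int i" by (auto elim!: Ints_cases)
    have "0 \<le> t * of_nat g" using t(1) by simp
    then have i0: "i \<ge> 0" using i by simp
    have "t * of_nat g \<le> 1 * of_nat g" using t(2) by (intro mult_right_mono) auto
    then have "of_int i \<le> (of_int (int g) :: rat)" using i by simp
    then have ig: "i \<le> int g" by (simp only: of_int_le_iff)
    have "y = u + of_nat (nat i) *s d" using yd i i0 by (simp add: algebra_simps)
    then show "y \<in> (\<lambda>k. u + of_nat k *s d) ` {0..g}" using i0 ig by (intro image_eqI[of _ _ "nat i"]) auto
  next
    fix y assume "y \<in> (\<lambda>k. u + of_nat k *s d) ` {0..g}"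
    then obtain k where k: "k \<le> g" "y = u + of_nat k *s d" by auto
    have "y \<in> N" using u primitive_N_D(1)[OF d(1)] by (simp add: k mem_N_iff)
    moreover have "y \<in> conv_hull {u, v}"
    proof (cases "g = 0")
      case True
      then show ?thesis using k conv_hull_subset[of "{u, v}"] by simp
    next
      case False
      define t :: rat where "t = of_nat k / of_nat g"
      have "of_nat k *s d = t *s (v - u)" using False by (simp add: d(2) t_def)
      then have "y = (1 - t) *s u + t *s v" by (simp add: k(2) algebra_simps)
      moreover have "0 \<le> t" "t \<le> 1" using k(1) False by (simp_all add: t_def)
      ultimately show ?thesis by (simp add: conv_hull_pairI)
    qed
    ultimately show "y \<in> conv_hull {u, v} \<inter> N" by simp
  qed
  moreover have "inj_on (\<lambda>k. u + of_nat k *s d) {0..g}"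
    by (rule inj_onI) (drule inj, simp)
  ultimately have "card (conv_hull {u, v} \<inter> N) = g + 1" by (simp add: card_image)
  then show ?thesis by (simp add: width_def gens)
qed

text \<open>Counterclockwise order fixes the sign: \<open>vdet (v - u) u = - vdet u v\<close> is
  negative, so the inner normal is \<open>vdet d\<close> and not its negative.\<close>

lemma cone_invariants:
  assumes prim: "primitive_N u" "primitive_N v" and det: "vdet u v > 0"
  defines "\<sigma> \<equiv> cone_hull {u, v}"
  shows "prim_gens \<sigma> = {u, v}" "width \<sigma> > 0" "primitive_M (inner_normal \<sigma>)" "inner_normal \<sigma> \<in> M"
    "of_nat (width \<sigma>) * inner_normal \<sigma> x = vdet (v - u) x"
    "inner_normal \<sigma> u < 0" "inner_normal \<sigma> v = inner_normal \<sigma> u" "local_index \<sigma> > 0"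
proof -
  show gens: "prim_gens \<sigma> = {u, v}" unfolding \<sigma>_def
    by (rule prim_gens_cone_hull) (use prim det in auto)
  have N: "u \<in> N" "v \<in> N" "v - u \<in> N" using primitive_N_D(1)[OF prim(1)] primitive_N_D(1)[OF prim(2)]
    by (auto simp: mem_N_iff)
  have "v - u \<noteq> 0" using det by (auto simp: vdet_simps)
  then obtain g d where g: "g > 0" and d: "primitive_N d" and vu: "v - u = of_nat g *s d"
    using primitive_direction[OF N(3)] by blast
  have dx: "of_nat g * vdet d x = vdet (v - u) x" for x by (simp add: vu vdet_simps)
  have "of_nat g * vdet d u < 0" unfolding dx using det vdet_swap[of u v] by (simp add: vdet_simps)
  then have du: "vdet d u < 0" using g by (simp add: mult_less_0_iff)
  have "of_nat g * vdet d (v - u) = 0" unfolding dx by (simp add: vdet_simps)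
  then have dv: "vdet d v = vdet d u" using g by (simp add: vdet_simps(4))
  have m: "inner_normal \<sigma> = vdet d"
    by (rule inner_normal_eqI[OF gens _ primitive_M_vdet_iff[THEN iffD2, OF d]]) (use det du dv in auto)
  have w: "width \<sigma> = g" by (rule width_eqI[OF gens N(1) d vu])
  show "width \<sigma> > 0" "of_nat (width \<sigma>) * inner_normal \<sigma> x = vdet (v - u) x"
    "inner_normal \<sigma> u < 0" "inner_normal \<sigma> v = inner_normal \<sigma> u"
    using g dx du dv by (simp_all add: w m)
  show "primitive_M (inner_normal \<sigma>)" using primitive_M_vdet_iff[THEN iffD2, OF d] by (simp add: m)
  then show M: "inner_normal \<sigma> \<in> M" by (simp add: primitive_M_def primitive_def)
  obtain i :: int where i: "vdet d u = of_int i" using M_D(2)[OF M N(1)] by (auto simp: m elim!: Ints_cases)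
  have "local_index \<sigma> = nat (- i)" unfolding local_index_def gens m
  proof (rule the_equality)
    show "\<forall>u\<in>{u, v}. of_nat (nat (- i)) = - vdet d u" using i du dv by simp
    fix l assume "\<forall>u\<in>{u, v}. of_nat l = - vdet d u"
    then have "of_int (int l) = (of_int (- i) :: rat)" using i by simp
    then have "int l = - i" by (simp only: of_int_eq_iff)
    then show "l = nat (- i)" by simp
  qed
  then show "local_index \<sigma> > 0" using i du by simp
qed

text \<open>\<open>vdet e b2\<close> and \<open>- vdet e b1\<close> are the coordinates of
  \<open>e\<close>, so for \<open>e\<close> in \<open>N\<close> the determinant of \<open>m\<close>
  with \<open>vdet e\<close> is just \<open>m e\<close>. Here \<open>e\<close> is
  \<open>v - u\<close>, and the width has been cleared from the normal.\<close>

lemma M_det_inner_normal: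
  assumes prim: "primitive_N u" "primitive_N v" and det: "vdet u v > 0" and m: "m \<in> M"
  shows "of_nat (width (cone_hull {u, v})) * M_det m (inner_normal (cone_hull {u, v})) = m (v - u)"
proof -
  note inv = cone_invariants[OF prim det]
  have "m (v - u) = m (coord1 (v - u) *s b1 + coord2 (v - u) *s b2)" by (subst (1) coords[of "v - u"]) (rule refl)
  also have "\<dots> = m b1 * vdet (v - u) b2 - m b2 * vdet (v - u) b1"
    unfolding M_linear[OF m] by (simp add: vdet_def algebra_simps)
  finally show ?thesis
    unfolding M_det_eq[OF m inv(4) frame] inv(5)[symmetric] by (simp add: algebra_simps)
qed

lemma M_det_swap:
  assumes "m \<in> M" "m' \<in> M" shows "M_det m m' = - M_det m' m"
  unfolding M_det_eq[OF assms frame] M_det_eq[OF assms(2,1) frame] by simp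

section \<open>Standard refinements\<close>

text \<open>All points used for subdividing lie on the line through \<open>u\<close> and
  \<open>v\<close>, where the normal of \<open>\<sigma>\<close> is constant and negative; that
  normal therefore serves each piece as well.\<close>

lemma ray_subdivision_cone:
  assumes prim: "primitive_N u" "primitive_N v" and det: "vdet u v > 0"
  defines "\<sigma> \<equiv> cone_hull {u, v}"
  assumes R: "R \<subseteq> conv_hull {u, v}" "\<forall>x\<in>R. primitive_N x" and \<tau>: "\<tau> \<in> ray_subdivision \<sigma> R"
  shows "prim_gens \<tau> \<noteq> {}" "\<And>a. a \<in> prim_gens \<tau> \<Longrightarrow> inner_normal \<sigma> a = inner_normal \<sigma> u"
    "inner_normal \<tau> = inner_normal \<sigma>"
proof -
  note inv = cone_invariants[OF prim det, folded \<sigma>_def]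
  obtain a b where \<tau>_eq: "\<tau> = cone_hull {a, b}" and ab: "a \<in> R \<union> {u, v}" "b \<in> R \<union> {u, v}" "a \<noteq> b"
    using \<tau> by (auto simp: ray_subdivision_def inv(1))
  have on_line: "inner_normal \<sigma> y = inner_normal \<sigma> u" if y: "y \<in> R \<union> {u, v}" for y
  proof -
    have "y \<in> conv_hull {u, v}" using y R(1) conv_hull_subset by blast
    then obtain t where t: "y = (1 - t) *s u + t *s v" by (rule conv_hull_pairE)
    show ?thesis unfolding t M_linear[OF inv(4)] inv(7) by (simp add: algebra_simps)
  qed
  have pa: "primitive_N a" "primitive_N b" using ab R(2) prim by auto
  \<comment> \<open>Parallel points at the same nonzero height coincide.\<close>
  have det': "vdet a b \<noteq> 0"
  proof
    assume "vdet a b = 0"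
    then obtain t where t: "b = t *s a" using vdet_0_parallel[OF primitive_N_D(2)[OF pa(1)]] by blast
    then have "inner_normal \<sigma> b = t * inner_normal \<sigma> a"
      using linear_functional_comb(2)[OF M_D(1)[OF inv(4)]] by simp
    then have "t = 1" using on_line[OF ab(1)] on_line[OF ab(2)] inv(6) by simp
    then show False using t ab(3) by simp
  qed
  have gens: "prim_gens \<tau> = {a, b}" unfolding \<tau>_eq using det' pa by (rule prim_gens_cone_hull)
  show "inner_normal \<tau> = inner_normal \<sigma>"
    by (rule inner_normal_eqI[OF gens det' inv(3)]) (use on_line[OF ab(1)] on_line[OF ab(2)] inv(6) in auto)
  show "prim_gens \<tau> \<noteq> {}" by (simp add: gens)
  show "inner_normal \<sigma> y = inner_normal \<sigma> u" if "y \<in> prim_gens \<tau>" for y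
    by (rule on_line) (use that ab gens in auto)
qed

text \<open>The total width is read off the prescribed counts, as
  \<open>(width \<sigma> div l) * l + \<rho>\<close>, with no geometric additivity of
  widths.\<close>

lemma standard_cone_refinement_D:
  assumes prim: "primitive_N u" "primitive_N v" and det: "vdet u v > 0"
  defines "\<sigma> \<equiv> cone_hull {u, v}"
  assumes ref: "standard_cone_refinement \<sigma> T"
  shows "finite T" "(\<Sum>\<tau>\<in>T. width \<tau>) = width \<sigma>"
    "\<tau> \<in> T \<Longrightarrow> inner_normal \<tau> = inner_normal \<sigma> \<and>
      prim_gens \<tau> \<noteq> {} \<and> (\<forall>a\<in>prim_gens \<tau>. inner_normal \<sigma> a = inner_normal \<sigma> u)"
proof -
  note inv = cone_invariants[OF prim det, folded \<sigma>_def]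
  define l where "l = local_index \<sigma>"
  define \<rho> where "\<rho> = width \<sigma> mod l"
  have l: "l > 0" using inv(8) by (simp add: l_def)
  obtain R where R: "R \<subseteq> conv_hull {u, v}" "\<forall>x\<in>R. primitive_N x" "T = ray_subdivision \<sigma> R"
    using ref unfolding standard_cone_refinement_def Let_def inv(1) by blast
  have widths: "width \<tau> = l \<or> \<rho> > 0 \<and> width \<tau> = \<rho>" if "\<tau> \<in> T" for \<tau>
    using ref that unfolding standard_cone_refinement_def Let_def l_def \<rho>_def by blast
  have cards: "card {\<tau>\<in>T. width \<tau> = l} = width \<sigma> div l" "\<rho> > 0 \<longrightarrow> card {\<tau>\<in>T. width \<tau> = \<rho>} = 1"
    using ref unfolding standard_cone_refinement_def Let_def l_def \<rho>_def by blast+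
  \<comment> \<open>An infinite set has cardinality 0 and would give width \<open>0 - 1 = 0\<close>;
    positive width thus proves finiteness.\<close>
  have "card (conv_hull {u, v} \<inter> N) > 0" using inv(2) by (simp add: width_def inv(1))
  then have "finite (conv_hull {u, v} \<inter> N)" by (rule card_ge_0_finite)
  moreover have "R \<subseteq> conv_hull {u, v} \<inter> N" using R primitive_N_D(1) by blast
  ultimately have "finite R" by (rule finite_subset[rotated])
  then have "finite (R \<union> {u, v})" by simp
  then have "finite ((\<lambda>(a, b). cone_hull {a, b}) ` ((R \<union> {u, v}) \<times> (R \<union> {u, v})))" by blast
  moreover have "T \<subseteq> (\<lambda>(a, b). cone_hull {a, b}) ` ((R \<union> {u, v}) \<times> (R \<union> {u, v}))"
    by (auto simp: R(3) ray_subdivision_def inv(1))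
  ultimately show fin: "finite T" by (rule finite_subset[rotated])
  have "(\<Sum>\<tau>\<in>T. width \<tau>) = (\<Sum>\<tau>\<in>{\<tau>\<in>T. width \<tau> = l}. width \<tau>) + (\<Sum>\<tau>\<in>{\<tau>\<in>T. width \<tau> \<noteq> l}. width \<tau>)"
    using fin by (subst sum.union_disjoint[symmetric]) (auto intro: sum.cong)
  also have "(\<Sum>\<tau>\<in>{\<tau>\<in>T. width \<tau> = l}. width \<tau>) = (width \<sigma> div l) * l"
    using cards(1) by simp
  also have "(\<Sum>\<tau>\<in>{\<tau>\<in>T. width \<tau> \<noteq> l}. width \<tau>) = \<rho>"
  proof (cases "\<rho> > 0")
    case True
    have "\<rho> < l" using l by (simp add: \<rho>_def)
    then have "{\<tau>\<in>T. width \<tau> \<noteq> l} = {\<tau>\<in>T. width \<tau> = \<rho>}" using widths by auto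
    then show ?thesis using cards(2) True by simp
  next
    case False
    have empty: "{\<tau>\<in>T. width \<tau> \<noteq> l} = {}" using widths False by blast
    show ?thesis unfolding empty using False by simp
  qed
  finally show "(\<Sum>\<tau>\<in>T. width \<tau>) = width \<sigma>" by (simp add: \<rho>_def)
  assume "\<tau> \<in> T"
  then have "\<tau> \<in> ray_subdivision \<sigma> R" using R(3) by simp
  then show "inner_normal \<tau> = inner_normal \<sigma> \<and>
      prim_gens \<tau> \<noteq> {} \<and> (\<forall>a\<in>prim_gens \<tau>. inner_normal \<sigma> a = inner_normal \<sigma> u)"
    using ray_subdivision_cone[OF prim det R(1,2)] unfolding \<sigma>_def by blast
qed

end


section \<open>The spanning fan and its quiver\<close>

context lattice_frame
begin

text \<open>The arcs from one vertex to another number the positive part of the determinant; the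
  opposite arcs number its negative part, and the difference is the determinant.\<close>

lemma signed_arrows_quiv:
  assumes "\<sigma> \<in> \<Sigma>" "\<tau> \<in> \<Sigma>" "inner_normal \<sigma> \<in> M" "inner_normal \<tau> \<in> M"
  shows "of_int (signed_arrows (quiv \<Sigma>) \<sigma> \<tau>) = M_det (inner_normal \<sigma>) (inner_normal \<tau>)"
proof -
  have count: "of_nat (card {e \<in> arcs (quiv \<Sigma>). tail (quiv \<Sigma>) e = x \<and> head (quiv \<Sigma>) e = y})
      = max 0 (M_det (inner_normal x) (inner_normal y))"
    if x: "x \<in> \<Sigma>" "inner_normal x \<in> M" and y: "y \<in> \<Sigma>" "inner_normal y \<in> M" for x y
  proof -
    obtain i :: int where i: "M_det (inner_normal x) (inner_normal y) = of_int i"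
      using M_det_Ints[OF x(2) y(2)] by (auto elim!: Ints_cases)
    have less: "of_nat k < \<bar>of_int i :: rat\<bar> \<longleftrightarrow> int k < \<bar>i\<bar>" for k
      by (metis of_int_abs of_int_less_iff of_int_of_nat_eq)
    have "{e \<in> arcs (quiv \<Sigma>). tail (quiv \<Sigma>) e = x \<and> head (quiv \<Sigma>) e = y} = (\<lambda>k. (x, y, k)) ` {..<nat i}"
      using x y by (auto simp: quiv_def i less)
    moreover have "inj_on (\<lambda>k. (x, y, k)) {..<nat i}" by (simp add: inj_on_def)
    ultimately have "card {e \<in> arcs (quiv \<Sigma>). tail (quiv \<Sigma>) e = x \<and> head (quiv \<Sigma>) e = y} = nat i"
      by (simp add: card_image)
    then show ?thesis by (simp add: i max_def)
  qed
  show ?thesis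
    unfolding signed_arrows_def using count[of \<sigma> \<tau>] count[of \<tau> \<sigma>] assms M_det_swap[OF assms(3,4)]
    by (simp add: max_def)
qed

text \<open>Cones outside the neighbourhood have nonpositive determinant and add 0, so the sum can
  run over all of \<open>\<Sigma>\<close> and be regrouped by edges.\<close>

lemma sum_out_nbrs_quiv:
  assumes fin: "finite \<Sigma>" and M: "\<And>\<tau>. \<tau> \<in> \<Sigma> \<Longrightarrow> inner_normal \<tau> \<in> M" and \<sigma>: "\<sigma> \<in> \<Sigma>"
  shows "of_int (\<Sum>h\<in>out_nbrs (quiv \<Sigma>) \<sigma>. int (fst (label (quiv \<Sigma>) h)) * signed_arrows (quiv \<Sigma>) \<sigma> h)
    = (\<Sum>\<tau>\<in>\<Sigma>. of_nat (width \<tau>) * max 0 (M_det (inner_normal \<sigma>) (inner_normal \<tau>)))"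
    (is "of_int (sum ?g ?O) = sum ?h \<Sigma>")
proof -
  have O: "?O = {\<tau> \<in> \<Sigma>. M_det (inner_normal \<sigma>) (inner_normal \<tau>) > 0}"
    using \<sigma> by (force simp: out_nbrs_def quiv_def intro!: exI[of _ 0])
  have "sum ?h \<Sigma> = (\<Sum>\<tau>\<in>?O. of_int (?g \<tau>))"
  proof (rule sum.mono_neutral_cong_right[OF fin])
    fix \<tau> assume "\<tau> \<in> ?O"
    then have \<tau>: "\<tau> \<in> \<Sigma>" "M_det (inner_normal \<sigma>) (inner_normal \<tau>) > 0" by (auto simp: O)
    show "?h \<tau> = of_int (?g \<tau>)"
      using signed_arrows_quiv[OF \<sigma> \<tau>(1) M[OF \<sigma>] M[OF \<tau>(1)]] \<tau>(2) by (simp add: quiv_def)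
  qed (auto simp: O)
  then show ?thesis by simp
qed

lemma sum_in_nbrs_quiv:
  assumes fin: "finite \<Sigma>" and M: "\<And>\<tau>. \<tau> \<in> \<Sigma> \<Longrightarrow> inner_normal \<tau> \<in> M" and \<sigma>: "\<sigma> \<in> \<Sigma>"
  shows "of_int (\<Sum>t\<in>in_nbrs (quiv \<Sigma>) \<sigma>. int (fst (label (quiv \<Sigma>) t)) * signed_arrows (quiv \<Sigma>) t \<sigma>)
    = (\<Sum>\<tau>\<in>\<Sigma>. of_nat (width \<tau>) * max 0 (- M_det (inner_normal \<sigma>) (inner_normal \<tau>)))"
    (is "of_int (sum ?g ?I) = sum ?h \<Sigma>")
proof -
  have swap: "- M_det (inner_normal \<sigma>) (inner_normal \<tau>) = M_det (inner_normal \<tau>) (inner_normal \<sigma>)" if "\<tau> \<in> \<Sigma>" for \<tau>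
    using M_det_swap[OF M[OF \<sigma>] M[OF that]] by simp
  have I: "?I = {\<tau> \<in> \<Sigma>. M_det (inner_normal \<tau>) (inner_normal \<sigma>) > 0}"
    using \<sigma> by (force simp: in_nbrs_def quiv_def intro!: exI[of _ 0])
  have "sum ?h \<Sigma> = (\<Sum>\<tau>\<in>?I. of_int (?g \<tau>))"
  proof (rule sum.mono_neutral_cong_right[OF fin])
    fix \<tau> assume "\<tau> \<in> ?I"
    then have \<tau>: "\<tau> \<in> \<Sigma>" "M_det (inner_normal \<tau>) (inner_normal \<sigma>) > 0" by (auto simp: I)
    show "?h \<tau> = of_int (?g \<tau>)"
      using signed_arrows_quiv[OF \<tau>(1) \<sigma> M[OF \<tau>(1)] M[OF \<sigma>]] \<tau> swap[OF \<tau>(1)] by (simp add: quiv_def)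
  qed (auto simp: I swap)
  then show ?thesis by simp
qed

end

locale fano_frame = polygon +
  assumes fano: "fano_polygon (conv_hull S)"
begin

section \<open>Faces of the polygon and maximal cones of the spanning fan\<close>

lemma edge_primitive:
  assumes "(u, v) \<in> edges" shows "primitive_N u" "primitive_N v" "vdet u v > 0"
  using edgesD(1-3)[OF assms] is_vertex_face fano by (auto simp: fano_polygon_def)

lemma edge_face:
  assumes "(u, v) \<in> edges"
  defines "F \<equiv> {y \<in> P. vdet (v - u) y = vdet v u}"
  shows "face P F" "F \<noteq> P" "cone_hull F = cone_hull {u, v}" "{u, v} \<subseteq> F"
proof -
  note e = edgesD[OF assms(1)]
  \<comment> \<open>\<open>face\<close> bounds its functional from above, \<open>edges\<close> from
    below; hence the opposite sign.\<close>
  show "face P F" unfolding face_def F_def using e(4)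
    by (intro exI[of _ "vdet (u - v)"] exI[of _ "- vdet v u"])
      (auto simp: linear_vdet vdet_simps algebra_simps)
  have "0 \<notin> F" using e(3) vdet_swap[of u v] by (simp add: F_def vdet_simps)
  then show "F \<noteq> P" using zero_in_P by blast
  show uv: "{u, v} \<subseteq> F" using e by (auto simp: F_def vdet_simps vdet_swap[of u v])
  have "F \<subseteq> cone_hull {u, v}" using e(5) conv_hull_pair_subset_cone_hull[OF e(8)] by (auto simp: F_def)
  then show "cone_hull F = cone_hull {u, v}" by (rule cone_hull_between[OF e(8) uv])
qed

text \<open>The zero functional yields only \<open>P\<close> and the empty set; for any other
  functional the height is positive because the origin is interior.\<close>

lemma proper_face:
  assumes "face P F" "F \<noteq> P"
  obtains c h where "c \<noteq> 0" "h > 0" "\<And>y. y \<in> P \<Longrightarrow> vdet c y \<le> h" "F = {y \<in> P. vdet c y = h}" | "F = {}"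
proof -
  obtain f h where f: "Vector_Spaces.linear scale (*) f" "\<forall>y\<in>P. f y \<le> h" "F = {y \<in> P. f y = h}"
    using assms(1) unfolding face_def by (elim exE conjE) (rule that)
  define c where "c = f b2 *s b1 - f b1 *s b2"
  have fc: "f y = vdet c y" for y unfolding c_def by (rule linear_functional_eq_vdet[OF f(1)])
  show ?thesis
  proof (cases "c = 0")
    case True
    then have "F = {y \<in> P. 0 = h}" using f(3) by (simp add: fc vdet_simps)
    then have "F = {}" using assms(2) by (cases "h = 0") auto
    then show ?thesis by (rule that(2))
  next
    case False
    have le: "vdet c y \<le> h" if "y \<in> P" for y using f(2) that by (simp add: fc)
    show ?thesis using that(1)[OF False support_pos[OF False le] le] f(3) by (simp add: fc)
  qed
qed

lemma proper_face_subset_edge: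
  assumes "face P F" "F \<noteq> P"
  obtains u v where "(u, v) \<in> edges" "F \<subseteq> conv_hull {u, v}"
proof (cases "F = {}")
  case True
  then show ?thesis using edges_nonempty that by fastforce
next
  case False
  show ?thesis using assms
  proof (rule proper_face)
    fix c h assume c: "c \<noteq> 0" "\<And>y. y \<in> P \<Longrightarrow> vdet c y \<le> h" and F: "F = {y \<in> P. vdet c y = h}"
    have "\<exists>y\<in>P. vdet c y = h" using False F by auto
    then obtain v w where "(v, w) \<in> edges" "\<And>y. y \<in> P \<Longrightarrow> vdet c y = h \<Longrightarrow> y \<in> conv_hull {v, w}"
      using supporting_edge[OF c] by metis
    then show ?thesis using that F by blast
  qed (use False in simp)
qed

text \<open>
  Membership in the cone over a face bounds the coefficient sum from above by the functional of the
  face, and from below by the functional of any edge containing the point.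
\<close>

lemma edge_cone_subset_imp_eq:
  assumes uv: "(u, v) \<in> edges" and F: "face P F" "F \<noteq> P" and sub: "cone_hull {u, v} \<subseteq> cone_hull F"
  shows "cone_hull F = cone_hull {u, v}"
proof -
  note e = edgesD[OF uv]
  define E where "E = {y \<in> P. vdet (v - u) y = vdet v u}"
  have neg: "vdet v u < 0" using e(3) vdet_swap[of u v] by simp
  have gens: "u \<in> cone_hull F" "v \<in> cone_hull F"
    using sub cone_hull_pairI[of 1 0 u v] cone_hull_pairI[of 0 1 u v] e(8) by auto
  have *: "\<exists>T k. w = (\<Sum>y\<in>T. k y *s y) \<and> T \<subseteq> F \<and> (\<forall>y\<in>T. 0 \<le> k y) \<and> 1 \<le> sum k T"
    if w: "w \<in> cone_hull F" "vdet (v - u) w = vdet v u" for w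
  proof -
    obtain T k where T: "w = (\<Sum>y\<in>T. k y *s y)" "T \<subseteq> F" "\<forall>y\<in>T. 0 \<le> k y"
      using w(1) unfolding cone_hull_def by blast
    have "F \<subseteq> P" using F(1) by (auto simp: face_def)
    have "vdet v u = (\<Sum>y\<in>T. k y * vdet (v - u) y)"
      using w(2) by (simp add: T(1) linear_functional_comb[OF linear_vdet])
    also have "\<dots> \<ge> (\<Sum>y\<in>T. k y * vdet v u)"
      using T \<open>F \<subseteq> P\<close> e(4) by (intro sum_mono mult_left_mono) auto
    finally have "sum k T * vdet v u \<le> 1 * vdet v u" by (simp add: sum_distrib_right)
    then have "1 \<le> sum k T" using neg by (simp only: mult_le_cancel_right)
    then show ?thesis using T by blast
  qed
  show ?thesis using F
  proof (rule proper_face)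
    assume "F = {}"
    then show ?thesis using *[OF gens(1)] by (auto simp: vdet_simps)
  next
    fix c h assume h: "h > 0" and le: "\<And>y. y \<in> P \<Longrightarrow> vdet c y \<le> h" and F_eq: "F = {y \<in> P. vdet c y = h}"
    have on: "vdet c w = h" if w: "w \<in> cone_hull F" "w \<in> P" "vdet (v - u) w = vdet v u" for w
    proof -
      obtain T k where T: "w = (\<Sum>y\<in>T. k y *s y)" "T \<subseteq> F" "1 \<le> sum k T"
        using *[OF w(1,3)] by blast
      have "vdet c w = (\<Sum>y\<in>T. k y * vdet c y)" by (simp add: T(1) linear_functional_comb[OF linear_vdet])
      also have "\<dots> = (\<Sum>y\<in>T. k y * h)" using T(2) F_eq by (intro sum.cong) auto
      also have "\<dots> = sum k T * h" by (simp add: sum_distrib_right)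
      finally have "vdet c w \<ge> h" using T(3) h by simp
      then show ?thesis using le[OF w(2)] by simp
    qed
    have cu: "vdet c u = h" "vdet c v = h" using on[OF gens(1) e(6)] on[OF gens(2) e(7)] vdet_swap[of v u]
      by (simp_all add: vdet_simps)
    \<comment> \<open>Both ends of the edge lie on the supporting line of \<open>F\<close>, so the
      coefficients of \<open>y\<close> sum to 1 and \<open>y\<close> is on the line of the
      edge.\<close>
    have "y \<in> conv_hull {u, v}" if y: "y \<in> F" for y
    proof -
      have det: "vdet u v \<noteq> 0" using e(3) by simp
      obtain p q where pq: "y = p *s u + q *s v" using vdet_cramer[OF det] by blast
      have "vdet c y = h" "y \<in> P" using y F_eq by auto
      then have "(p + q) * h = 1 * h" using cu by (simp add: pq vdet_simps algebra_simps)
      then have "p + q = 1" using h by simp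
      then have p: "p = 1 - q" by simp
      have "vdet (v - u) y = vdet v u" by (simp add: pq p vdet_def algebra_simps)
      then show ?thesis using e(5) \<open>y \<in> P\<close> by blast
    qed
    then have "F \<subseteq> cone_hull {u, v}" using conv_hull_pair_subset_cone_hull[OF e(8)] by blast
    moreover have "{u, v} \<subseteq> F" using cu e F_eq by simp
    ultimately show ?thesis by (intro cone_hull_between e(8))
  qed
qed

text \<open>Every proper face lies in an edge, and no cone over a proper face strictly contains the
  cone over an edge.\<close>

lemma maximal_cones_eq: "maximal_cones (spanning_fan P) = (\<lambda>(u, v). cone_hull {u, v}) ` edges"
proof (intro equalityI subsetI)
  fix \<sigma> assume "\<sigma> \<in> maximal_cones (spanning_fan P)"
  then have max: "\<And>\<tau>. \<tau> \<in> spanning_fan P \<Longrightarrow> \<sigma> \<subseteq> \<tau> \<Longrightarrow> \<tau> = \<sigma>" and "\<sigma> \<in> spanning_fan P"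
    by (auto simp: maximal_cones_def)
  then obtain F where F: "\<sigma> = cone_hull F" "face P F" "F \<noteq> P" by (auto simp: spanning_fan_def)
  obtain u v where uv: "(u, v) \<in> edges" "F \<subseteq> conv_hull {u, v}" using F(2,3) by (rule proper_face_subset_edge)
  note f = edge_face[OF uv(1)]
  have "cone_hull {u, v} \<in> spanning_fan P" using f by (auto simp: spanning_fan_def intro!: exI[of _ "{y \<in> P. vdet (v - u) y = vdet v u}"])
  moreover have "\<sigma> \<subseteq> cone_hull {u, v}"
    using uv(2) conv_hull_pair_subset_cone_hull[OF edgesD(8)[OF uv(1)]]
      cone_hull_subset_pair[of F u v] by (auto simp: F(1) cone_hull_pair[OF edgesD(8)[OF uv(1)]])
  ultimately show "\<sigma> \<in> (\<lambda>(u, v). cone_hull {u, v}) ` edges" using max uv(1) by force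
next
  fix \<sigma> assume "\<sigma> \<in> (\<lambda>(u, v). cone_hull {u, v}) ` edges"
  then obtain u v where uv: "(u, v) \<in> edges" and \<sigma>: "\<sigma> = cone_hull {u, v}" by auto
  note f = edge_face[OF uv]
  have "\<sigma> \<in> spanning_fan P" using f by (auto simp: \<sigma> spanning_fan_def intro!: exI[of _ "{y \<in> P. vdet (v - u) y = vdet v u}"])
  moreover have "\<tau> = \<sigma>" if "\<tau> \<in> spanning_fan P" "\<sigma> \<subseteq> \<tau>" for \<tau>
    using that edge_cone_subset_imp_eq[OF uv] by (auto simp: \<sigma> spanning_fan_def)
  ultimately show "\<sigma> \<in> maximal_cones (spanning_fan P)" by (auto simp: maximal_cones_def)
qed

text \<open>The primitive generators recover the unordered pair, and the sign of \<open>vdet\<close>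
  recovers its order.\<close>

lemma edge_eqI:
  assumes uv: "(u, v) \<in> edges" and xy: "(x, y) \<in> edges" and eq: "cone_hull {u, v} = cone_hull {x, y}"
  shows "(u, v) = (x, y)"
proof -
  have "{u, v} = {x, y}"
    using arg_cong[OF eq, of prim_gens]
    unfolding cone_invariants(1)[OF edge_primitive[OF uv]] cone_invariants(1)[OF edge_primitive[OF xy]] .
  then have "(u = x \<and> v = y) \<or> (u = y \<and> v = x)" by (auto simp: doubleton_eq_iff)
  then show ?thesis using edge_primitive(3)[OF uv] edge_primitive(3)[OF xy] vdet_swap[of u v] by auto
qed

text \<open>An edge is the set of points of \<open>P\<close> where its inner normal is minimal.\<close>

lemma edge_eq_if_same_normal:
  assumes uv: "(u, v) \<in> edges" and xy: "(x, y) \<in> edges"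
    and m: "inner_normal (cone_hull {u, v}) = inner_normal (cone_hull {x, y})"
    and level: "inner_normal (cone_hull {u, v}) u = inner_normal (cone_hull {x, y}) x"
  shows "(u, v) = (x, y)"
proof -
  have face_eq: "{p \<in> P. vdet (b - a) p = vdet b a}
      = {p \<in> P. inner_normal (cone_hull {a, b}) p = inner_normal (cone_hull {a, b}) a}"
    if ab: "(a, b) \<in> edges" for a b
  proof -
    note inv = cone_invariants[OF edge_primitive[OF ab]]
    have "vdet (b - a) p = vdet b a \<longleftrightarrow> vdet (b - a) p = vdet (b - a) a" for p by (simp add: vdet_simps)
    then show ?thesis using inv(2) by (simp add: inv(5)[symmetric])
  qed
  have "cone_hull {u, v} = cone_hull {x, y}"
    using edge_face(3)[OF uv] edge_face(3)[OF xy]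
    unfolding face_eq[OF uv] face_eq[OF xy] m level[unfolded m]
    by (rule trans[OF sym])
  then show ?thesis by (rule edge_eqI[OF uv xy])
qed

text \<open>\<open>\<phi>\<close> is arbitrary because the pieces of an edge cone share its normal
  and have its total width. It is used with the positive and with the negative part of the
  determinant.\<close>

lemma sum_standard_refinement:
  fixes \<phi> :: "('a \<Rightarrow> rat) \<Rightarrow> rat"
  assumes ref: "standard_refinement P \<Sigma>"
  shows "finite \<Sigma>" "\<tau> \<in> \<Sigma> \<Longrightarrow> inner_normal \<tau> \<in> M"
    "(\<Sum>\<tau>\<in>\<Sigma>. of_nat (width \<tau>) * \<phi> (inner_normal \<tau>)) =
     (\<Sum>(u, v)\<in>edges. of_nat (width (cone_hull {u, v})) * \<phi> (inner_normal (cone_hull {u, v})))"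
proof -
  obtain T where T: "\<And>\<sigma>. \<sigma> \<in> maximal_cones (spanning_fan P) \<Longrightarrow> standard_cone_refinement \<sigma> (T \<sigma>)"
    and \<Sigma>: "\<Sigma> = (\<Union>\<sigma>\<in>maximal_cones (spanning_fan P). T \<sigma>)"
    using ref unfolding standard_refinement_def by blast
  define C where "C = (\<lambda>(u, v). cone_hull {u, v})"
  define U where "U = (\<lambda>e. T (C e))"
  have \<Sigma>_eq: "\<Sigma> = (\<Union>e\<in>edges. U e)" by (simp add: \<Sigma> maximal_cones_eq U_def C_def)
  have ref_e: "standard_cone_refinement (cone_hull {u, v}) (U (u, v))" if "(u, v) \<in> edges" for u v
    using T that by (auto simp: maximal_cones_eq U_def C_def)
  note D = standard_cone_refinement_D[OF edge_primitive ref_e]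
  have fin: "finite (U e)" if "e \<in> edges" for e
    using D(1) that by (cases e) auto
  then show "finite \<Sigma>" using finite_edges by (simp add: \<Sigma>_eq)
  show "inner_normal \<tau> \<in> M" if "\<tau> \<in> \<Sigma>"
  proof -
    obtain u v where uv: "(u, v) \<in> edges" "\<tau> \<in> U (u, v)" using \<open>\<tau> \<in> \<Sigma>\<close> by (auto simp: \<Sigma>_eq)
    then show ?thesis using D(3)[OF uv(1,1,1,1) uv(2)] cone_invariants(4)[OF edge_primitive[OF uv(1)]] by simp
  qed
  \<comment> \<open>\<open>\<Sigma>\<close> is a set, so a piece common to two edges would be
    counted once. Such a piece has the normal of both edges, and any of its generators gives both
    the same level, so the edges agree.\<close>
  have disj: "U e \<inter> U e' = {}" if "e \<in> edges" "e' \<in> edges" "e \<noteq> e'" for e e'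
  proof (rule ccontr)
    assume "U e \<inter> U e' \<noteq> {}"
    then obtain \<tau> where \<tau>: "\<tau> \<in> U e" "\<tau> \<in> U e'" by blast
    obtain u v x y where e: "e = (u, v)" "e' = (x, y)" by (metis prod.exhaust)
    have uv: "(u, v) \<in> edges" and xy: "(x, y) \<in> edges" using that e by auto
    note Du = D(3)[OF uv uv uv uv \<tau>(1)[unfolded e]] and Dx = D(3)[OF xy xy xy xy \<tau>(2)[unfolded e]]
    obtain a where a: "a \<in> prim_gens \<tau>" using Du by blast
    have m: "inner_normal (cone_hull {u, v}) = inner_normal (cone_hull {x, y})" using Du Dx by simp
    have "inner_normal (cone_hull {u, v}) u = inner_normal (cone_hull {x, y}) x" using Du Dx a m by metis
    then show False using edge_eq_if_same_normal[OF uv xy m] that(3) e by simp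
  qed
  have "(\<Sum>\<tau>\<in>\<Sigma>. of_nat (width \<tau>) * \<phi> (inner_normal \<tau>))
      = (\<Sum>e\<in>edges. \<Sum>\<tau>\<in>U e. of_nat (width \<tau>) * \<phi> (inner_normal \<tau>))"
    unfolding \<Sigma>_eq using finite_edges fin disj by (intro sum.UNION_disjoint) auto
  also have "\<dots> = (\<Sum>(u, v)\<in>edges. of_nat (width (cone_hull {u, v})) * \<phi> (inner_normal (cone_hull {u, v})))"
  proof (rule sum.cong[OF refl])
    fix e assume "e \<in> edges"
    then obtain u v where e: "e = (u, v)" and uv: "(u, v) \<in> edges" by (cases e) auto
    have "(\<Sum>\<tau>\<in>U e. of_nat (width \<tau>) * \<phi> (inner_normal \<tau>))
        = (\<Sum>\<tau>\<in>U e. of_nat (width \<tau>) * \<phi> (inner_normal (cone_hull {u, v})))"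
      using D(3)[OF uv uv uv uv] by (intro sum.cong) (auto simp: e)
    also have "\<dots> = of_nat (\<Sum>\<tau>\<in>U e. width \<tau>) * \<phi> (inner_normal (cone_hull {u, v}))"
      by (simp add: sum_distrib_right)
    also have "(\<Sum>\<tau>\<in>U e. width \<tau>) = width (cone_hull {u, v})" using D(2)[OF uv uv uv uv] by (simp add: e)
    finally show "(\<Sum>\<tau>\<in>U e. of_nat (width \<tau>) * \<phi> (inner_normal \<tau>))
        = (case e of (u, v) \<Rightarrow> of_nat (width (cone_hull {u, v})) * \<phi> (inner_normal (cone_hull {u, v})))"
      by (simp add: e)
  qed
  finally show "(\<Sum>\<tau>\<in>\<Sigma>. of_nat (width \<tau>) * \<phi> (inner_normal \<tau>)) =
     (\<Sum>(u, v)\<in>edges. of_nat (width (cone_hull {u, v})) * \<phi> (inner_normal (cone_hull {u, v})))" .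
qed

section \<open>The height range and the two quiver sums\<close>

lemma height_range_eq:
  assumes "p \<in> P" "q \<in> P" "\<forall>y\<in>P. f q \<le> f y \<and> f y \<le> f p"
  shows "height_range P f = real_of_rat (f p - f q)"
proof -
  have "h_max P f = real_of_rat (f p)" unfolding h_max_def
    using assms by (intro cSup_eq_maximum) (auto simp: of_rat_less_eq)
  moreover have "h_min P f = real_of_rat (f q)" unfolding h_min_def
    using assms by (intro cInf_eq_minimum) (auto simp: of_rat_less_eq)
  ultimately show ?thesis by (simp add: height_range_def of_rat_diff)
qed

lemma height_range_quiv:
  assumes ref: "standard_refinement P \<Sigma>" and \<sigma>: "\<sigma> \<in> \<Sigma>"
  shows "height_range P (inner_normal \<sigma>) = real_of_int (\<Sum>h\<in>out_nbrs (quiv \<Sigma>) \<sigma>.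
      int (fst (label (quiv \<Sigma>) h)) * signed_arrows (quiv \<Sigma>) \<sigma> h)" (is "_ = real_of_int ?out")
    and "height_range P (inner_normal \<sigma>) = real_of_int (\<Sum>t\<in>in_nbrs (quiv \<Sigma>) \<sigma>.
      int (fst (label (quiv \<Sigma>) t)) * signed_arrows (quiv \<Sigma>) t \<sigma>)" (is "_ = real_of_int ?in")
proof -
  note R = sum_standard_refinement[OF ref]
  define m where "m = inner_normal \<sigma>"
  have m: "m \<in> M" using R(2)[OF \<sigma>] by (simp add: m_def)
  note lin = linear_functional_comb[OF M_D(1)[OF m]]
  obtain p q where pq: "p \<in> P" "q \<in> P" "\<forall>y\<in>P. m q \<le> m y \<and> m y \<le> m p"
    and up: "(\<Sum>(u, v)\<in>edges. max 0 (m (v - u))) = m p - m q"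
    and down: "(\<Sum>(u, v)\<in>edges. max 0 (m (u - v))) = m p - m q"
    by (rule sum_increasing_edges[OF M_D(1)[OF m]])
  \<comment> \<open>A width is nonnegative and moves inside \<open>max 0\<close>, so each edge
    contributes the positive part of its height gain or loss.\<close>
  have pull: "of_nat w * max 0 x = max 0 (of_nat w * x)" for w :: nat and x :: rat
    by (simp add: max_mult_distrib_left)
  have det: "of_nat (width (cone_hull {u, v})) * M_det m (inner_normal (cone_hull {u, v})) = m (v - u)"
    if "(u, v) \<in> edges" for u v using M_det_inner_normal[OF edge_primitive[OF that] m] .
  have "of_int ?out = (\<Sum>\<tau>\<in>\<Sigma>. of_nat (width \<tau>) * max 0 (M_det m (inner_normal \<tau>)))"
    unfolding m_def by (rule sum_out_nbrs_quiv[OF R(1,2) \<sigma>])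
  also have "\<dots> = (\<Sum>(u, v)\<in>edges. max 0 (m (v - u)))"
    unfolding R(3)[of "\<lambda>m'. max 0 (M_det m m')"] by (rule sum.cong) (auto simp: pull det)
  finally have out: "of_int ?out = m p - m q" using up by simp
  have "of_int ?in = (\<Sum>\<tau>\<in>\<Sigma>. of_nat (width \<tau>) * max 0 (- M_det m (inner_normal \<tau>)))"
    unfolding m_def by (rule sum_in_nbrs_quiv[OF R(1,2) \<sigma>])
  also have "\<dots> = (\<Sum>(u, v)\<in>edges. max 0 (m (u - v)))"
    unfolding R(3)[of "\<lambda>m'. max 0 (- M_det m m')"] by (rule sum.cong) (auto simp: pull det lin)
  finally have "in": "of_int ?in = m p - m q" using down by simp
  have hr: "height_range P m = real_of_rat (m p - m q)" using pq by (rule height_range_eq)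
  show "height_range P (inner_normal \<sigma>) = real_of_int ?out"
    unfolding m_def[symmetric] hr out[symmetric] by (rule of_rat_of_int_eq)
  show "height_range P (inner_normal \<sigma>) = real_of_int ?in"
    unfolding m_def[symmetric] hr "in"[symmetric] by (rule of_rat_of_int_eq)
qed

end

theorem proposition3p1:
  fixes scale :: "rat \<Rightarrow> 'v::ab_group_add \<Rightarrow> 'v"
    and N :: "'v set" and Or :: "('v \<times> 'v) set"
    and P :: "'v set" and \<Sigma> :: "'v set set"
    and Q :: "('v set, 'v set \<times> 'v set \<times> nat, 'v \<Rightarrow> rat) vector_quiver"
  assumes "oriented_lattice scale N Or"
    and "oriented_lattice.fano_polygon scale N P"
    and "oriented_lattice.standard_refinement scale N P \<Sigma>"
    and "Q = oriented_lattice.quiv scale N Or \<Sigma>"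
    and "m \<in> verts Q"
  shows "height_range P (vec Q m) = real_of_int (\<Sum>h\<in>out_nbrs Q m. int (fst (label Q h)) * signed_arrows Q m h) \<and>
         height_range P (vec Q m) = real_of_int (\<Sum>t\<in>in_nbrs Q m. int (fst (label Q t)) * signed_arrows Q t m)"
proof -
  interpret oriented_lattice scale N Or by (rule assms(1))
  obtain b1 b2 where "(b1, b2) \<in> Or" using Or_nonempty by auto
  moreover obtain S where S: "finite S" "P = conv_hull S"
    using assms(2) unfolding fano_polygon_def lattice_polytope_def by blast
  ultimately interpret fano_frame scale N Or b1 b2 S
    using assms(2) by unfold_locales (auto simp: fano_polygon_def)
  have "m \<in> \<Sigma>" using assms(4,5) by (simp add: quiv_def)
  then show ?thesis
    using height_range_quiv[of \<Sigma> m] assms(3) by (simp add: S(2) assms(4)) (simp add: quiv_def)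
qed

end
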